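(* Let $a:\mathbb{R}\to\mathbb{R}$ be the even function given by $a=2$ in $(-1,1)$ and $a=1$ in $\mathbb{R}\setminus[-1,1]$. Let $\varphi\in\dot H^1(\mathbb{R})$ be the unique solution of $\partial_x(a(x)\partial_x\varphi)+a(x)\sin\varphi\cos\varphi=0$ in $\mathbb{R}\setminus\{0\}$ under the constraints $\varphi(0)=0$ and $\varphi(\pm\infty)=\pm\frac{\pi}{2}$ that satisfies $-\frac{\pi}{2}\le\varphi(-x)\le0\le\varphi(x)\le\frac{\pi}{2}$ for every $x>0$, and let $m=(\sin\varphi,\cos\varphi,0)$, which is the unique minimizer of $F$ among maps $\mathbb{R}\to\mathbb{S}^2$ under the constraints $m(0)=e_2$ and $m(\pm\infty)=\pm e_1$. Then $\varphi$ is unstable, i.e., $Q(\eta)<0$ for some direction $\eta\in H^1(\mathbb{R})$. Consequently, the constrained minimizer $m$ is unstable, i.e., $T(v)<0$ for some direction $v\in H^1(\mathbb{R},\mathbb{R}^3)$ with $v\cdot m=0$ in $\mathbb{R}$. Moreover, there is no minimizer $\tilde m:\mathbb{R}\to\mathbb{S}^2$ of $F$ under the constraints $\tilde m(\pm\infty)=\pm e_1$.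
   Context: $e_1=(1,0,0)$, $e_2=(0,1,0)$, and $\mathbb{S}^2$ is the unit sphere in $\mathbb{R}^3$. For the weight $a$ (its values at the two points $\pm1$ are irrelevant) and $m=(m_1,m_2,m_3):\mathbb{R}\to\mathbb{S}^2$, $$F(m)=\int_{\mathbb{R}}\Big(a(x)|\partial_x m|^2+a(x)(m_2^2+m_3^2)\Big)\,dx,$$ and for $\phi:\mathbb{R}\to\mathbb{R}$, $$G(\phi)=F\big((\sin\phi,\cos\phi,0)\big)=\int_{\mathbb{R}}\Big(a(x)(\partial_x\phi)^2+a(x)\cos^2\phi\Big)\,dx.$$ Competitors are in $H^1_{loc}$, identified with their continuous representatives, and the functionals take values in $[0,+\infty]$. $\dot H^1(\mathbb{R})$ is the set of functions $\phi\in H^1_{loc}(\mathbb{R})$ with $\partial_x\phi\in L^2(\mathbb{R})$. The notation $f(\pm\infty)=\pm c$ means $\lim_{x\to+\infty}f(x)=c$ and $\lim_{x\to-\infty}f(x)=-c$. Differential equations are understood in the sense of distributions. The existence and uniqueness of $\varphi$ and the fact that $m=(\sin\varphi,\cos\varphi,0)$ is the unique minimizer of $F$ under $m(0)=e_2$, $m(\pm\infty)=\pm e_1$ hold for every measurable weight bounded between two positive constants, and may be taken as known. The second variations are $$Q(\eta)=\frac12\frac{d^2}{dt^2}\bigg|_{t=0}G(\varphi+t\eta)=\int_{\mathbb{R}}\Big(a(x)(\partial_x\eta)^2-a(x)\cos(2\varphi(x))\,\eta^2\Big)\,dx,\qquad \eta\in H^1(\mathbb{R}),$$ $$T(v)=\frac12\frac{d^2}{dt^2}\bigg|_{t=0}F\bigg(\frac{m+tv}{|m+tv|}\bigg)=\int_{\mathbb{R}}\Big(a(x)|\partial_x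 v|^2+a(x)(v_2^2+v_3^2)-\lambda(x)|v|^2\Big)\,dx$$ for $v=(v_1,v_2,v_3)\in H^1(\mathbb{R},\mathbb{R}^3)$ with $v\cdot m=0$ in $\mathbb{R}$, where $\lambda(x)=a(x)|\partial_x m|^2+a(x)m_2^2$. *)

theory Defs
  imports "HOL-Analysis.Analysis"
begin

definition test_function :: "real set \<Rightarrow> (real \<Rightarrow> real) \<Rightarrow> bool" where
  "test_function U \<psi> \<longleftrightarrow>
     (\<forall>n x. (deriv ^^ n) \<psi> field_differentiable at x) \<and>
     (\<exists>K. compact K \<and> K \<subseteq> U \<and> (\<forall>x. x \<notin> K \<longrightarrow> \<psi> x = 0))"

definition locally_integrable :: "real set \<Rightarrow> (real \<Rightarrow> 'a::euclidean_space) \<Rightarrow> bool" where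
  "locally_integrable U f \<longleftrightarrow> (\<forall>K. compact K \<and> K \<subseteq> U \<longrightarrow> set_integrable lborel K f)"

text \<open>The equation \<open>\<partial>\<^sub>x f = g\<close> in the sense of distributions on the open set \<open>U\<close>.\<close>

definition has_weak_deriv ::
    "real set \<Rightarrow> (real \<Rightarrow> 'a::euclidean_space) \<Rightarrow> (real \<Rightarrow> 'a) \<Rightarrow> bool" where
  "has_weak_deriv U f g \<longleftrightarrow>
     locally_integrable U f \<and> locally_integrable U g \<and>
     (\<forall>\<psi>. test_function U \<psi> \<longrightarrow>
        (LBINT x. deriv \<psi> x *\<^sub>R f x) = - (LBINT x. \<psi> x *\<^sub>R g x))"

text \<open>A weak derivative on the whole line is unique only up to null sets; the choice of
  representative does not affect any of the integrals or weak derivatives formed from it below.\<close>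

definition weak_deriv :: "(real \<Rightarrow> 'a::euclidean_space) \<Rightarrow> real \<Rightarrow> 'a" where
  "weak_deriv f = (SOME g. has_weak_deriv UNIV f g)"

definition L2 :: "(real \<Rightarrow> 'a::euclidean_space) set" where
  "L2 = {f. f \<in> borel_measurable lborel \<and> integrable lborel (\<lambda>x. (norm (f x))\<^sup>2)}"

text \<open>Elements of the Sobolev spaces are identified with their continuous representatives.\<close>

definition H1_loc :: "(real \<Rightarrow> 'a::euclidean_space) set" where
  "H1_loc = {f. continuous_on UNIV f \<and>
     (\<exists>g. has_weak_deriv UNIV f g \<and> locally_integrable UNIV (\<lambda>x. (norm (g x))\<^sup>2))}"

definition homogeneous_H1 :: "(real \<Rightarrow> 'a::euclidean_space) set" where
  "homogeneous_H1 = {f \<in> H1_loc. weak_deriv f \<in> L2}"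

definition H1 :: "(real \<Rightarrow> 'a::euclidean_space) set" where
  "H1 = {f \<in> H1_loc. f \<in> L2 \<and> weak_deriv f \<in> L2}"

definition energy :: "(real \<Rightarrow> real) \<Rightarrow> (real \<Rightarrow> real^3) \<Rightarrow> ennreal" where
  "energy a m = (\<integral>\<^sup>+x. ennreal (a x * (norm (weak_deriv m x))\<^sup>2
                               + a x * ((m x $ 2)\<^sup>2 + (m x $ 3)\<^sup>2)) \<partial>lborel)"

definition transition_map :: "(real \<Rightarrow> real^3) \<Rightarrow> bool" where
  "transition_map m \<longleftrightarrow> m \<in> H1_loc \<and> (\<forall>x. m x \<in> sphere 0 1) \<and>
     (m \<longlongrightarrow> axis 1 1) at_top \<and> (m \<longlongrightarrow> - axis 1 1) at_bot"

text \<open>Half the second derivative at \<open>t = 0\<close> of the energy of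
  \<open>(sin (\<phi> + t \<eta>), cos (\<phi> + t \<eta>), 0)\<close>.\<close>

definition second_variation_angle ::
    "(real \<Rightarrow> real) \<Rightarrow> (real \<Rightarrow> real) \<Rightarrow> (real \<Rightarrow> real) \<Rightarrow> real" where
  "second_variation_angle a \<phi> \<eta> =
     (LBINT x. a x * (weak_deriv \<eta> x)\<^sup>2 - a x * cos (2 * \<phi> x) * (\<eta> x)\<^sup>2)"

definition lagrange_multiplier :: "(real \<Rightarrow> real) \<Rightarrow> (real \<Rightarrow> real^3) \<Rightarrow> real \<Rightarrow> real" where
  "lagrange_multiplier a m x = a x * (norm (weak_deriv m x))\<^sup>2 + a x * (m x $ 2)\<^sup>2"

text \<open>Half the second derivative at \<open>t = 0\<close> of the energy of \<open>(m + t v) / |m + t v|\<close>,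
  for \<open>m = (sin \<phi>, cos \<phi>, 0)\<close> critical and \<open>v\<close> tangent along \<open>m\<close>.\<close>

definition second_variation_map ::
    "(real \<Rightarrow> real) \<Rightarrow> (real \<Rightarrow> real^3) \<Rightarrow> (real \<Rightarrow> real^3) \<Rightarrow> real" where
  "second_variation_map a m v =
     (LBINT x. a x * (norm (weak_deriv v x))\<^sup>2 + a x * ((v x $ 2)\<^sup>2 + (v x $ 3)\<^sup>2)
               - lagrange_multiplier a m x * (norm (v x))\<^sup>2)"

end

theory Submission imports Defs begin

text \<open>
  Let \<open>w = a \<partial>\<^sub>x \<phi>\<close> be the flux. On a half line the integrand of \<open>Q\<close> in direction \<open>w\<close> equals
  \<open>- a\<^sup>2 (w sin \<phi> cos \<phi>)'\<close>. This is exact away from the jump of \<open>a\<close>, so \<open>Q\<close> reduces to the jump of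
  \<open>a\<^sup>2\<close> and equals \<open>- 3 w(1) sin \<phi>(1) cos \<phi>(1) < 0\<close>. Rescaling the flux on one side of \<open>0\<close> makes it
  continuous there and gives \<open>\<eta>\<close>; turning it into the tangent direction
  \<open>v = \<eta> (cos \<phi>, - sin \<phi>, 0)\<close> gives \<open>T(v) = Q(\<eta>)\<close>.

  For the nonexistence, the transition profile of the constant weight \<open>1\<close> shifted to infinity shows
  that the infimum is at most \<open>4\<close>. Conversely
  \<open>a |\<partial>\<^sub>x m|\<^sup>2 + a (m\<^sub>2\<^sup>2 + m\<^sub>3\<^sup>2) \<ge> 2 \<partial>\<^sub>x m\<^sub>1\<close>, whose right-hand side integrates to \<open>4\<close>. Equality forces
  \<open>m\<^sub>1 = \<plusminus>1\<close> in the layer and \<open>\<partial>\<^sub>x m\<^sub>1 = 1 - m\<^sub>1\<^sup>2\<close>, hence \<open>m\<^sub>1\<close> constant on a half line.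
\<close>

section \<open>Test functions\<close>

text \<open>For a constant weight the derivative of the profile is the infinitesimal translation and
  lies in the kernel of \<open>Q\<close>. Here it jumps at the interfaces
  \<open>\<plusminus>1\<close> and is not admissible; the flux is its continuous substitute. Because
  \<open>m\<close> minimizes under the constraint at \<open>0\<close>, directions vanishing at
  \<open>0\<close> have nonnegative second variation, so a destabilizing direction must move the
  value at \<open>0\<close>; the one used here is positive there. The equation says nothing across
  \<open>0\<close>, so the flux may have two different one-sided limits, which is why each half line
  is treated separately. No boundary term arises at \<open>0\<close> since \<open>sin \<phi>\<close>
  vanishes there. The sign comes from the weight being larger near \<open>0\<close>: leaving the
  layer, \<open>a\<^sup>2\<close> drops from \<open>4\<close> to \<open>1\<close>. The functionals
  are built on a derivative chosen arbitrarily from an almost-everywhere class. Everything is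
  therefore transferred to the relation that \<open>f\<close> is a primitive of \<open>g\<close> on
  every interval, for which the product rule, uniqueness and the passage to classical derivatives
  can be proved.\<close>

definition smooth :: "(real \<Rightarrow> real) \<Rightarrow> bool" where
  "smooth f \<longleftrightarrow> (\<forall>n x. (deriv ^^ n) f field_differentiable at x)"

text \<open>A class of differentiable functions closed under \<open>deriv\<close> contains all
  higher derivatives of its members. Choosing \<open>P\<close> as a parametrized family of formulas
  avoids computing these derivatives.\<close>

lemma smooth_coinduct:
  assumes "P f" "\<And>f x. P f \<Longrightarrow> f field_differentiable at x" "\<And>f. P f \<Longrightarrow> P (deriv f)"
  shows "smooth f"
proof -
  have "P ((deriv ^^ n) f)" for n
    by (induction n) (use assms in auto)
  then show ?thesis
    using assms by (auto simp: smooth_def)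
qed

lemma smooth_differentiable: "smooth f \<Longrightarrow> f field_differentiable at x"
  unfolding smooth_def by (metis funpow_0)

lemma smooth_has_deriv: "smooth f \<Longrightarrow> (f has_real_derivative deriv f x) (at x)"
  by (simp add: DERIV_deriv_iff_field_differentiable smooth_differentiable)

lemma smooth_deriv: "smooth f \<Longrightarrow> smooth (deriv f)"
  unfolding smooth_def by (metis comp_apply funpow_Suc_right)

lemma smooth_continuous: "smooth f \<Longrightarrow> continuous_on A f"
  by (simp add: continuous_at_imp_continuous_on field_differentiable_imp_continuous_at smooth_differentiable)

lemma smooth_measurable [measurable_dest]: "smooth f \<Longrightarrow> f \<in> borel_measurable borel"
  by (simp add: borel_measurable_continuous_onI smooth_continuous)

lemma smoothI:
  assumes "\<And>x. (f has_real_derivative g x) (at x)" "smooth g"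
  shows "smooth f"
proof (rule smooth_coinduct[where P = "\<lambda>h. h = f \<or> smooth h"])
  fix h assume "h = f \<or> smooth h"
  moreover have "deriv f = g"
    using assms DERIV_imp_deriv by blast
  ultimately show "deriv h = f \<or> smooth (deriv h)"
    using assms smooth_deriv by auto
qed (use assms smooth_differentiable field_differentiable_def in blast)+

lemma smooth_linear_combination:
  assumes "smooth f" "smooth g"
  shows "smooth (\<lambda>x. c * f x + d * g x)"
proof (rule smooth_coinduct[where P = "\<lambda>h. \<exists>f g. smooth f \<and> smooth g \<and> h = (\<lambda>x. c * f x + d * g x)"])
  show "\<exists>f' g'. smooth f' \<and> smooth g' \<and> (\<lambda>x. c * f x + d * g x) = (\<lambda>x. c * f' x + d * g' x)"
    using assms by blast
next
  fix h :: "real \<Rightarrow> real" and x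
  assume "\<exists>f g. smooth f \<and> smooth g \<and> h = (\<lambda>x. c * f x + d * g x)"
  then obtain f g where fg: "smooth f" "smooth g" "h = (\<lambda>x. c * f x + d * g x)"
    by blast
  have d: "(h has_real_derivative c * deriv f x + d * deriv g x) (at x)" for x
    unfolding fg(3) by (intro DERIV_add DERIV_cmult smooth_has_deriv fg)
  show "h field_differentiable at x"
    using d field_differentiable_def by blast
next
  fix h :: "real \<Rightarrow> real"
  assume "\<exists>f g. smooth f \<and> smooth g \<and> h = (\<lambda>x. c * f x + d * g x)"
  then obtain f g where fg: "smooth f" "smooth g" "h = (\<lambda>x. c * f x + d * g x)"
    by blast
  have d: "(h has_real_derivative c * deriv f x + d * deriv g x) (at x)" for x
    unfolding fg(3) by (intro DERIV_add DERIV_cmult smooth_has_deriv fg)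
  then have "deriv h = (\<lambda>x. c * deriv f x + d * deriv g x)"
    using DERIV_imp_deriv by blast
  then show "\<exists>f g. smooth f \<and> smooth g \<and> deriv h = (\<lambda>x. c * f x + d * g x)"
    using fg smooth_deriv by blast
qed

lemma smooth_affine:
  assumes "smooth f"
  shows "smooth (\<lambda>x. f (c * x + d))"
\<comment> \<open>The extra factor \<open>k\<close> closes the class: every derivative produces
  another factor \<open>c\<close>.\<close>
proof (rule smooth_coinduct[where P = "\<lambda>h. \<exists>f k. smooth f \<and> h = (\<lambda>x. k * f (c * x + d))"])
  show "\<exists>f' k. smooth f' \<and> (\<lambda>x. f (c * x + d)) = (\<lambda>x. k * f' (c * x + d))"
    using assms by (intro exI[of _ f] exI[of _ 1]) auto
next
  fix h :: "real \<Rightarrow> real" and x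
  assume "\<exists>f k. smooth f \<and> h = (\<lambda>x. k * f (c * x + d))"
  then obtain f k where f: "smooth f" "h = (\<lambda>x. k * f (c * x + d))"
    by blast
  have "(h has_real_derivative k * (deriv f (c * x + d) * c)) (at x)" for x
    unfolding f(2)
    by (intro DERIV_cmult DERIV_chain'[OF _ smooth_has_deriv[OF f(1)]]) (auto intro!: derivative_eq_intros)
  then show "h field_differentiable at x"
    using field_differentiable_def by blast
next
  fix h :: "real \<Rightarrow> real"
  assume "\<exists>f k. smooth f \<and> h = (\<lambda>x. k * f (c * x + d))"
  then obtain f k where f: "smooth f" "h = (\<lambda>x. k * f (c * x + d))"
    by blast
  have "(h has_real_derivative k * (deriv f (c * x + d) * c)) (at x)" for x
    unfolding f(2)
    by (intro DERIV_cmult DERIV_chain'[OF _ smooth_has_deriv[OF f(1)]]) (auto intro!: derivative_eq_intros)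
  then have "deriv h = (\<lambda>x. (k * c) * deriv f (c * x + d))"
    using DERIV_imp_deriv by (auto simp: fun_eq_iff mult_ac)
  then show "\<exists>f k. smooth f \<and> deriv h = (\<lambda>x. k * f (c * x + d))"
    using f smooth_deriv by blast
qed

text \<open>Products are awkward for \<open>smooth_coinduct\<close>: the derivative of a product is
  a sum of two products, so a closed class would have to contain all finite sums of products.
  Counting the available derivatives permits induction on the order instead.\<close>

primrec k_smooth :: "nat \<Rightarrow> (real \<Rightarrow> real) \<Rightarrow> bool" where
  "k_smooth 0 f = True"
| "k_smooth (Suc n) f = ((\<forall>x. f field_differentiable at x) \<and> k_smooth n (deriv f))"

lemma smooth_iff_k_smooth: "smooth f \<longleftrightarrow> (\<forall>n. k_smooth n f)"
proof
  assume "smooth f"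
  then have "k_smooth n f" for n
    by (induction n arbitrary: f) (auto simp: smooth_deriv smooth_differentiable)
  then show "\<forall>n. k_smooth n f" by blast
next
  assume *: "\<forall>n. k_smooth n f"
  show "smooth f"
  proof (rule smooth_coinduct[where P = "\<lambda>f. \<forall>n. k_smooth n f"])
    show "f field_differentiable at x" if "\<forall>n. k_smooth n f" for f x
      using that[rule_format, of 1] by simp
    show "\<forall>n. k_smooth n (deriv f)" if "\<forall>n. k_smooth n f" for f
      using that k_smooth.simps(2) by blast
  qed (use * in blast)
qed

lemma k_smooth_pred: "k_smooth (Suc n) f \<Longrightarrow> k_smooth n f"
  by (induction n arbitrary: f) auto

lemma k_smooth_add: "k_smooth n f \<Longrightarrow> k_smooth n g \<Longrightarrow> k_smooth n (\<lambda>x. f x + g x)"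
proof (induction n arbitrary: f g)
  case (Suc n)
  then have "deriv (\<lambda>x. f x + g x) = (\<lambda>x. deriv f x + deriv g x)"
    by (intro ext deriv_add) auto
  then show ?case
    using Suc by (auto intro!: field_differentiable_add)
qed auto

lemma k_smooth_mult: "k_smooth n f \<Longrightarrow> k_smooth n g \<Longrightarrow> k_smooth n (\<lambda>x. f x * g x)"
proof (induction n arbitrary: f g)
  case (Suc n)
  then have d: "deriv (\<lambda>x. f x * g x) = (\<lambda>x. f x * deriv g x + deriv f x * g x)"
    by (intro ext deriv_mult) auto
  have "k_smooth n f" "k_smooth n g"
    using Suc.prems k_smooth_pred by blast+
  then show ?case
    using Suc by (auto simp: d intro!: field_differentiable_mult k_smooth_add)
qed auto

lemma smooth_mult: "smooth f \<Longrightarrow> smooth g \<Longrightarrow> smooth (\<lambda>x. f x * g x)"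
  by (simp add: smooth_iff_k_smooth k_smooth_mult)

text \<open>The functions \<open>p(1/x) exp(-1/x)\<close>, extended by \<open>0\<close> to \<open>x \<le> 0\<close>, are closed under differentiation.\<close>

definition flat :: "real poly \<Rightarrow> real \<Rightarrow> real" where
  "flat p x = (if x > 0 then poly p (1 / x) * exp (- (1 / x)) else 0)"

lemma poly_exp_tendsto_0: "((\<lambda>y. poly p y * exp (- y)) \<longlongrightarrow> (0::real)) at_top"
proof -
  have "((\<lambda>y. \<Sum>i\<le>degree p. coeff p i * (y ^ i / exp y)) \<longlongrightarrow> (\<Sum>i\<le>degree p. coeff p i * 0)) at_top"
    by (intro tendsto_sum tendsto_mult tendsto_const tendsto_power_div_exp_0)
  then show ?thesis
    by (simp add: poly_altdef sum_distrib_right exp_minus divide_inverse mult.assoc)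
qed

lemma flat_tendsto_0: "(flat p \<longlongrightarrow> 0) (at 0)"
proof -
  have "((\<lambda>x. poly p (inverse x) * exp (- inverse x)) \<longlongrightarrow> 0) (at_right 0)"
    by (rule filterlim_compose[OF poly_exp_tendsto_0 filterlim_inverse_at_top_right])
  then have "(flat p \<longlongrightarrow> 0) (at_right 0)"
    by (rule Lim_transform_eventually)
      (auto simp: flat_def inverse_eq_divide eventually_at_filter)
  moreover have "(flat p \<longlongrightarrow> 0) (at_left 0)"
    by (rule Lim_transform_eventually[of "\<lambda>_. 0"])
      (auto simp: flat_def eventually_at_filter)
  ultimately show ?thesis
    using filterlim_at_split by blast
qed

text \<open>With \<open>y = 1 / x\<close> one has \<open>d/dx = - y^2 d/dy\<close>, and this
  operator sends \<open>p(y) exp(-y)\<close> to \<open>y^2 (p - p')(y) exp(-y)\<close>.\<close>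

lemma flat_has_deriv: "(flat p has_real_derivative flat ([:0, 0, 1:] * (p - pderiv p)) x) (at x)"
proof -
  consider "x > 0" | "x < 0" | "x = 0" by linarith
  then show ?thesis
  proof cases
    case 1
    have "((\<lambda>x. poly p (1 / x) * exp (- (1 / x))) has_real_derivative
       flat ([:0, 0, 1:] * (p - pderiv p)) x) (at x)"
      using 1 by (auto intro!: derivative_eq_intros DERIV_chain'[OF _ poly_DERIV]
          simp: flat_def field_simps power2_eq_square)
    then show ?thesis
      by (rule DERIV_cong_ev[THEN iffD1, rotated -1])
        (use 1 in \<open>auto simp: flat_def intro!: eventually_mono[OF eventually_nhds_in_open[of "{0<..}"]]\<close>)
  next
    case 2
    have "((\<lambda>x. 0) has_real_derivative flat ([:0, 0, 1:] * (p - pderiv p)) x) (at x)"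
      using 2 by (auto simp: flat_def)
    then show ?thesis
      by (rule DERIV_cong_ev[THEN iffD1, rotated -1])
        (use 2 in \<open>auto simp: flat_def intro!: eventually_mono[OF eventually_nhds_in_open[of "{..<0}"]]\<close>)
  next
    case 3
    \<comment> \<open>The difference quotient at \<open>0\<close> is \<open>flat\<close> of the
      polynomial \<open>y p(y)\<close>, so its limit is an instance of
      \<open>flat_tendsto_0\<close>.\<close>
    have "(\<lambda>x. (flat p x - flat p 0) / (x - 0)) = flat ([:0, 1:] * p)"
      by (auto simp: flat_def fun_eq_iff)
    then show ?thesis
      using flat_tendsto_0[of "[:0, 1:] * p"] 3 by (simp add: has_field_derivative_iff flat_def)
  qed
qed

lemma smooth_flat: "smooth (flat p)"
proof (rule smooth_coinduct[where P = "\<lambda>f. \<exists>p. f = flat p"])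
  show "f field_differentiable at x" if "\<exists>p. f = flat p" for f x
    using that flat_has_deriv field_differentiable_def by blast
  show "\<exists>p. deriv f = flat p" if "\<exists>p. f = flat p" for f
    using that flat_has_deriv DERIV_imp_deriv by (metis ext)
qed blast

text \<open>As \<open>n\<close> grows these test functions increase to the indicator of the interval, so no mollifiers
  are needed.\<close>

definition bump :: "real \<Rightarrow> real \<Rightarrow> nat \<Rightarrow> real \<Rightarrow> real" where
  "bump p q n x = flat 1 (real (Suc n) * (x - p)) * flat 1 (real (Suc n) * (q - x))"

lemma smooth_bump: "smooth (bump p q n)"
proof -
  have "bump p q n = (\<lambda>x. flat 1 (real (Suc n) * x + (- real (Suc n) * p)) *
      flat 1 ((- real (Suc n)) * x + real (Suc n) * q))"
    by (auto simp: bump_def fun_eq_iff algebra_simps)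
  then show ?thesis
    by (auto intro!: smooth_mult smooth_affine smooth_flat)
qed

lemma bump_outside: "x \<notin> {p<..<q} \<Longrightarrow> bump p q n x = 0"
  by (auto simp: bump_def flat_def zero_less_mult_iff)

lemma bump_pos: "x \<in> {p<..<q} \<Longrightarrow> bump p q n x > 0"
  by (auto simp: bump_def flat_def)

lemma bump_nonneg: "bump p q n x \<ge> 0"
  using bump_outside[of x p q n] bump_pos[of x p q n] by force

lemma bump_le_1: "bump p q n x \<le> 1"
  by (auto simp: bump_def flat_def intro!: mult_le_one)

lemma flat_1_tendsto: "t > 0 \<Longrightarrow> (\<lambda>n. flat 1 (real (Suc n) * t)) \<longlonglongrightarrow> 1"
proof -
  assume t: "t > 0"
  have "(\<lambda>n. exp (- (1 / t * (1 / real (Suc n))))) \<longlonglongrightarrow> exp (- (1 / t * 0))"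
    by (intro tendsto_intros LIMSEQ_Suc lim_1_over_n)
  then show ?thesis
    using t by (simp add: flat_def mult_ac)
qed

lemma bump_tendsto: "(\<lambda>n. bump p q n x) \<longlonglongrightarrow> indicator {p<..<q} x"
proof (cases "x \<in> {p<..<q}")
  case True
  then have "(\<lambda>n. bump p q n x) \<longlonglongrightarrow> 1 * 1"
    unfolding bump_def by (intro tendsto_mult flat_1_tendsto) auto
  then show ?thesis using True by simp
qed (simp add: bump_outside)

lemma test_function_smooth:
  "test_function U \<psi> \<longleftrightarrow> smooth \<psi> \<and> (\<exists>K. compact K \<and> K \<subseteq> U \<and> (\<forall>x. x \<notin> K \<longrightarrow> \<psi> x = 0))"
  by (simp add: test_function_def smooth_def)

lemma test_function_bump: "{p..q} \<subseteq> U \<Longrightarrow> test_function U (bump p q n)"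
  unfolding test_function_smooth
  by (intro conjI exI[of _ "{p..q}"] smooth_bump) (auto intro!: bump_outside)

lemma test_function_mono: "test_function U \<psi> \<Longrightarrow> U \<subseteq> V \<Longrightarrow> test_function V \<psi>"
  unfolding test_function_def by blast

lemma deriv_outside_closed:
  assumes "closed K" "\<And>x. x \<notin> K \<Longrightarrow> \<psi> x = 0" "x \<notin> K"
  shows "deriv \<psi> x = (0::real)"
proof (rule DERIV_imp_deriv)
  have "((\<lambda>x. 0) has_real_derivative 0) (at x)" by simp
  then show "(\<psi> has_real_derivative 0) (at x)"
    by (rule DERIV_cong_ev[THEN iffD1, rotated -1])
      (use assms in \<open>auto intro!: eventually_mono[OF eventually_nhds_in_open[of "- K"]]\<close>)
qed

section \<open>Local integrability and the fundamental lemma of the calculus of variations\<close>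

lemma locally_integrable_mono: "locally_integrable U f \<Longrightarrow> V \<subseteq> U \<Longrightarrow> locally_integrable V f"
  unfolding locally_integrable_def by blast

lemma locally_integrable_set:
  "locally_integrable U f \<Longrightarrow> {p..q} \<subseteq> U \<Longrightarrow> set_integrable lborel {p..q} f"
  unfolding locally_integrable_def by auto

lemma locally_integrable_times_bounded:
  assumes "locally_integrable U f" "h \<in> borel_measurable borel" "compact K" "K \<subseteq> U"
    "\<And>x. x \<notin> K \<Longrightarrow> h x = 0" "\<And>x. \<bar>h x\<bar> \<le> B"
  shows "integrable lborel (\<lambda>x. h x *\<^sub>R f x)"
proof -
  have i: "integrable lborel (\<lambda>x. indicator K x *\<^sub>R f x)"
    using assms by (auto simp: locally_integrable_def set_integrable_def)
  have "integrable lborel (\<lambda>x. h x *\<^sub>R (indicator K x *\<^sub>R f x))"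
  proof (rule Bochner_Integration.integrable_bound[where f = "\<lambda>x. B *\<^sub>R (indicator K x *\<^sub>R f x)"])
    have [measurable]: "(\<lambda>x. indicator K x *\<^sub>R f x) \<in> borel_measurable borel" "h \<in> borel_measurable borel"
      using i assms by auto
    show "(\<lambda>x. h x *\<^sub>R (indicator K x *\<^sub>R f x)) \<in> borel_measurable lborel"
      by measurable
    show "AE x in lborel. norm (h x *\<^sub>R indicat_real K x *\<^sub>R f x) \<le> norm (B *\<^sub>R indicat_real K x *\<^sub>R f x)"
      using order_trans[OF assms(6) abs_ge_self] by (auto intro!: AE_I2 mult_right_mono simp: abs_mult)
  qed (intro integrable_scaleR_right i)
  moreover have "(\<lambda>x. h x *\<^sub>R (indicator K x *\<^sub>R f x)) = (\<lambda>x. h x *\<^sub>R f x)"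
    by (rule ext) (metis assms(5) indicator_simps scaleR_one scaleR_zero_left)
  ultimately show ?thesis by simp
qed

lemma compact_support_bounded:
  assumes "continuous_on UNIV h" "compact K" "\<And>x. x \<notin> K \<Longrightarrow> h x = (0::real)"
  obtains B where "\<And>x. \<bar>h x\<bar> \<le> B"
proof -
  have "bounded (h ` K)"
    using assms by (auto intro!: compact_imp_bounded compact_continuous_image intro: continuous_on_subset)
  then obtain B where B: "\<forall>x\<in>K. \<bar>h x\<bar> \<le> B"
    by (auto simp: bounded_iff)
  show thesis
    by (rule that[of "max B 0"]) (use B assms(3) in \<open>force simp: max_def\<close>)
qed

lemma integrable_times_test:
  assumes "locally_integrable U f" "test_function U \<psi>"
  shows "integrable lborel (\<lambda>x. \<psi> x *\<^sub>R f x)"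
proof -
  obtain K where K: "compact K" "K \<subseteq> U" "\<And>x. x \<notin> K \<Longrightarrow> \<psi> x = 0" "smooth \<psi>"
    using assms by (auto simp: test_function_smooth)
  obtain B where "\<And>x. \<bar>\<psi> x\<bar> \<le> B"
    using compact_support_bounded K smooth_continuous by metis
  then show ?thesis
    using K assms by (intro locally_integrable_times_bounded[of U f \<psi> K B] smooth_measurable) auto
qed

lemma test_function_deriv: "test_function U \<psi> \<Longrightarrow> test_function U (deriv \<psi>)"
  unfolding test_function_smooth using smooth_deriv deriv_outside_closed compact_imp_closed by metis

lemma test_function_interval:
  assumes "test_function U \<psi>" "is_interval U" "U \<noteq> {}"
  obtains p q where "p \<le> q" "{p..q} \<subseteq> U" "\<And>x. x \<notin> {p..q} \<Longrightarrow> \<psi> x = 0"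
proof -
  obtain K where K: "compact K" "K \<subseteq> U" "\<And>x. x \<notin> K \<Longrightarrow> \<psi> x = 0"
    using assms by (auto simp: test_function_def)
  show thesis
  proof (cases "K = {}")
    case True
    with K assms show ?thesis
      by (metis that all_not_in_conv atLeastAtMost_singleton empty_subsetI insert_subset order_refl)
  next
    case False
    obtain p where p: "p \<in> K" "\<And>x. x \<in> K \<Longrightarrow> p \<le> x"
      using compact_attains_inf[OF K(1) False] by blast
    obtain q where q: "q \<in> K" "\<And>x. x \<in> K \<Longrightarrow> x \<le> q"
      using compact_attains_sup[OF K(1) False] by blast
    have "{p..q} \<subseteq> U"
      using assms(2) p q K(2) unfolding is_interval_1 by (meson atLeastAtMost_iff subset_iff)
    then show ?thesis
      using p q K(3) by (intro that[of p q]) (auto intro: p(2))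
  qed
qed

text \<open>Dominated convergence along \<open>bump p q n\<close>, with the absolute value of
  \<open>h\<close> on the interval as majorant. The limit is the indicator of the open interval; the
  end points form a null set.\<close>

lemma set_integral_zero_of_test:
  fixes h :: "real \<Rightarrow> real"
  assumes "locally_integrable U h" "\<And>\<psi>. test_function U \<psi> \<Longrightarrow> (LBINT x. \<psi> x * h x) = 0"
    "{p..q} \<subseteq> U"
  shows "(LBINT x:{p..q}. h x) = 0"
proof -
  have i: "integrable lborel (\<lambda>x. indicator {p..q} x * h x)"
    using locally_integrable_set[OF assms(1,3)] by (simp add: set_integrable_def)
  then have [measurable]: "(\<lambda>x. indicator {p..q} x * h x) \<in> borel_measurable lborel"
    by blast
  have [measurable]: "bump p q n \<in> borel_measurable lborel" for n
    using smooth_measurable[OF smooth_bump] by simp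
  have e: "bump p q n x * (indicator {p..q} x * h x) = bump p q n x * h x" for n x
    by (cases "x \<in> {p<..<q}") (auto simp: bump_outside)
  have "(\<lambda>n. LBINT x. bump p q n x * (indicator {p..q} x * h x)) \<longlonglongrightarrow> (LBINT x. indicator {p<..<q} x * (indicator {p..q} x * h x))"
  proof (rule integral_dominated_convergence[where w = "\<lambda>x. \<bar>indicator {p..q} x * h x\<bar>"])
    show "AE x in lborel. norm (bump p q n x * (indicator {p..q} x * h x)) \<le> \<bar>indicat_real {p..q} x * h x\<bar>" for n
      using bump_le_1[of p q n] bump_nonneg[of p q n] by (auto simp: abs_mult intro!: mult_left_le_one_le)
  qed (use i in \<open>auto intro!: tendsto_intros bump_tendsto\<close>)
  moreover have "(LBINT x. bump p q n x * h x) = 0" for n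
    using assms test_function_bump by blast
  ultimately have "0 = (LBINT x. indicator {p<..<q} x * (indicator {p..q} x * h x))"
    by (simp add: e LIMSEQ_const_iff)
  also have "\<dots> = (LBINT x. indicator {p..q} x * h x)"
  proof (rule integral_cong_AE)
    show "AE x in lborel. indicat_real {p<..<q} x * (indicat_real {p..q} x * h x) = indicat_real {p..q} x * h x"
      using AE_lborel_singleton[of p] AE_lborel_singleton[of q] by eventually_elim (auto simp: indicator_def)
  qed measurable
  finally show ?thesis
    by (simp add: set_lebesgue_integral_def)
qed

text \<open>The positive and negative parts of \<open>h\<close> are densities of two finite
  measures. These agree on all rays \<open>{x<..}\<close>, hence coincide, and densities are unique
  up to null sets.\<close>

lemma AE_zero_of_tail_integrals:
  fixes h :: "real \<Rightarrow> real"
  assumes h: "integrable lborel h" and z: "\<And>x. (LBINT t:{x<..}. h t) = 0"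
  shows "AE x in lborel. h x = 0"
proof -
  have [measurable]: "h \<in> borel_measurable lborel" using h by blast
  let ?M = "density lborel (\<lambda>x. ennreal (max 0 (h x)))"
  let ?N = "density lborel (\<lambda>x. ennreal (max 0 (- h x)))"
  have i: "integrable lborel (\<lambda>t. indicator {x<..} t * max 0 (h t))"
      "integrable lborel (\<lambda>t. indicator {x<..} t * max 0 (- h t))" for x
    using h by (auto intro!: integrable_real_mult_indicator[where A = "{x<..}", simplified mult.commute] simp: mult.commute[of "indicator _ _"])
  have M: "emeasure ?M {x<..} = ennreal (LBINT t. indicator {x<..} t * max 0 (h t))" for x
    using i[of x] by (subst nn_integral_eq_integral[symmetric])
      (auto simp: emeasure_density indicator_mult_ennreal mult.commute)
  have N: "emeasure ?N {x<..} = ennreal (LBINT t. indicator {x<..} t * max 0 (- h t))" for x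
    using i[of x] by (subst nn_integral_eq_integral[symmetric])
      (auto simp: emeasure_density indicator_mult_ennreal mult.commute)
  have "(LBINT t. indicator {x<..} t * max 0 (h t)) - (LBINT t. indicator {x<..} t * max 0 (- h t)) = 0" for x
    using z[of x] unfolding set_lebesgue_integral_def
    by (subst Bochner_Integration.integral_diff[symmetric, OF i])
      (simp add: right_diff_distrib[symmetric] max_def cong: if_cong, smt (verit, best) Bochner_Integration.integral_cong)
  then have "?M = ?N"
    by (intro measure_eqI_lessThan) (auto simp: M N)
  then have "AE x in lborel. ennreal (max 0 (h x)) = ennreal (max 0 (- h x))"
    by (subst sigma_finite_measure.density_unique_iff[OF lborel.sigma_finite_measure_axioms, symmetric]) auto
  then show ?thesis
    by eventually_elim (auto simp: max_def split: if_splits)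
qed

lemma AE_zero_of_interval_integrals:
  fixes h :: "real \<Rightarrow> real"
  assumes "open U" "locally_integrable U h" "\<And>p q. {p..q} \<subseteq> U \<Longrightarrow> (LBINT x:{p..q}. h x) = 0"
  shows "AE x in lborel. x \<in> U \<longrightarrow> h x = 0"
proof -
  have *: "AE x in lborel. x \<in> {p..q} \<longrightarrow> h x = 0" if "{p..q} \<subseteq> U" for p q
  proof -
    have "AE x in lborel. indicator {p..q} x * h x = 0"
    proof (rule AE_zero_of_tail_integrals)
      show "integrable lborel (\<lambda>x. indicator {p..q} x * h x)"
        using locally_integrable_set[OF assms(2) that] by (simp add: set_integrable_def)
      fix x
      \<comment> \<open>A tail integral of the truncated function is an integral over a subinterval,
        possibly empty, up to the single point \<open>x\<close>.\<close>
      have "(LBINT t:{x<..}. indicator {p..q} t * h t) = (LBINT t:{max p x..q}. h t)"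
      proof -
        have [measurable]: "(\<lambda>x. indicator {p..q} x * h x) \<in> borel_measurable lborel"
          using locally_integrable_set[OF assms(2) that] by (auto simp: set_integrable_def)
        have "set_integrable lborel {max p x..q} h"
          by (rule locally_integrable_set[OF assms(2)]) (use that in auto)
        then have [measurable]: "(\<lambda>t. indicator {max p x..q} t * h t) \<in> borel_measurable lborel"
          by (auto simp: set_integrable_def)
        show ?thesis
          unfolding set_lebesgue_integral_def real_scaleR_def
        proof (rule integral_cong_AE)
          show "AE t in lborel. indicat_real {x<..} t * (indicat_real {p..q} t * h t) = indicat_real {max p x..q} t * h t"
            using AE_lborel_singleton[of x] by eventually_elim (auto simp: indicator_def)
        qed measurable
      qed
      also have "\<dots> = 0" using that by (intro assms(3)) auto
      finally show "(LBINT t:{x<..}. indicator {p..q} t * h t) = 0" .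
    qed
    then show ?thesis by eventually_elim (auto simp: indicator_def)
  qed
  \<comment> \<open>The closed rational intervals contained in an open set cover it, so countably
    many exceptional null sets suffice.\<close>
  have "AE x in lborel. \<forall>r s::rat. {of_rat r..of_rat s} \<subseteq> U \<longrightarrow> x \<in> {of_rat r..of_rat s} \<longrightarrow> h x = 0"
    unfolding AE_all_countable using * by (auto simp: AE_conj_iff)
  then show ?thesis
  proof eventually_elim
    case (elim x)
    show ?case
    proof
      assume "x \<in> U"
      then obtain e where e: "e > 0" "cball x e \<subseteq> U"
        using assms(1) open_contains_cball by blast
      obtain r s where "x - e < of_rat r" "of_rat r < x" "x < of_rat s" "of_rat s < x + e"
        using of_rat_dense[of "x - e" x] of_rat_dense[of x "x + e"] e by auto
      moreover from this have "{of_rat r..of_rat s} \<subseteq> cball x e"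
        by (auto simp: cball_eq_atLeastAtMost)
      ultimately show "h x = 0"
        using elim[rule_format, of r s] e by auto
    qed
  qed
qed

lemma fundamental_lemma:
  fixes h :: "real \<Rightarrow> real"
  assumes "open U" "locally_integrable U h" "\<And>\<psi>. test_function U \<psi> \<Longrightarrow> (LBINT x. \<psi> x * h x) = 0"
  shows "AE x in lborel. x \<in> U \<longrightarrow> h x = 0"
  using assms set_integral_zero_of_test by (intro AE_zero_of_interval_integrals) blast+

section \<open>Weak derivatives and absolutely continuous functions\<close>

lemma locally_integrable_scaleR_continuous:
  assumes "locally_integrable UNIV f" "continuous_on UNIV h"
  shows "locally_integrable UNIV (\<lambda>x. h x *\<^sub>R f x)"
  unfolding locally_integrable_def
proof (intro allI impI)
  fix K :: "real set" assume K: "compact K \<and> K \<subseteq> UNIV"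
  then have "bounded (h ` K)"
    using assms by (auto intro!: compact_imp_bounded compact_continuous_image intro: continuous_on_subset)
  then obtain B where B: "\<forall>x\<in>K. \<bar>h x\<bar> \<le> B"
    by (auto simp: bounded_iff)
  have [measurable]: "h \<in> borel_measurable borel" "K \<in> sets borel"
    using assms K by (auto intro: borel_measurable_continuous_onI borel_compact)
  have "integrable lborel (\<lambda>x. (indicator K x * h x) *\<^sub>R f x)"
    by (rule locally_integrable_times_bounded[OF assms(1), where B = "max B 0" and K = K])
      (use K B in \<open>auto simp: indicator_def max_def abs_mult split: if_splits\<close>)
  then show "set_integrable lborel K (\<lambda>x. h x *\<^sub>R f x)"
    by (simp add: set_integrable_def)
qed

lemma locally_integrable_mult_continuous:
  fixes f h :: "real \<Rightarrow> real"
  assumes "locally_integrable UNIV f" "continuous_on UNIV h"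
  shows "locally_integrable UNIV (\<lambda>x. h x * f x)" "locally_integrable UNIV (\<lambda>x. f x * h x)"
  using locally_integrable_scaleR_continuous[OF assms] by (simp_all add: mult.commute)

lemma locally_integrable_continuous:
  "continuous_on UNIV f \<Longrightarrow> locally_integrable UNIV f"
  unfolding locally_integrable_def set_integrable_def
  by (intro allI impI borel_integrable_compact) (auto intro: continuous_on_subset)

lemma locally_integrable_add:
  "locally_integrable U f \<Longrightarrow> locally_integrable U g \<Longrightarrow> locally_integrable U (\<lambda>x. f x + g x)"
  unfolding locally_integrable_def by auto

lemma locally_integrable_diff:
  "locally_integrable U f \<Longrightarrow> locally_integrable U g \<Longrightarrow> locally_integrable U (\<lambda>x. f x - g x)"
  unfolding locally_integrable_def by auto

lemma locally_integrable_inner: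
  "locally_integrable U f \<Longrightarrow> locally_integrable U (\<lambda>x. f x \<bullet> b)"
  unfolding locally_integrable_def set_integrable_def
proof (intro allI impI)
  fix K :: "real set"
  assume "\<forall>K. compact K \<and> K \<subseteq> U \<longrightarrow> integrable lborel (\<lambda>x. indicat_real K x *\<^sub>R f x)" "compact K \<and> K \<subseteq> U"
  then have "integrable lborel (\<lambda>x. (indicator K x *\<^sub>R f x) \<bullet> b)"
    by (intro integrable_inner_left) blast
  then show "integrable lborel (\<lambda>x. indicat_real K x *\<^sub>R (f x \<bullet> b))"
    by simp
qed

lemma locally_integrable_measurable:
  fixes f :: "real \<Rightarrow> 'a::euclidean_space"
  assumes "locally_integrable UNIV f"
  shows "f \<in> borel_measurable borel"
proof (rule borel_measurable_LIMSEQ_metric)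
  have "integrable lborel (\<lambda>x. indicator {- real n..real n} x *\<^sub>R f x)" for n
    using assms by (auto simp: locally_integrable_def set_integrable_def)
  then show "(\<lambda>x. indicator {- real n..real n} x *\<^sub>R f x) \<in> borel_measurable borel" for n
    using borel_measurable_integrable by fastforce
  fix x
  obtain N where N: "\<bar>x\<bar> \<le> real N"
    using real_arch_simple by blast
  have "\<forall>\<^sub>F n in sequentially. f x = indicator {- real n..real n} x *\<^sub>R f x"
    using eventually_ge_at_top[of N]
  proof eventually_elim
    case (elim n)
    then have "x \<in> {- real n..real n}" using N by auto
    then show ?case by simp
  qed
  then show "(\<lambda>n. indicator {- real n..real n} x *\<^sub>R f x) \<longlonglongrightarrow> f x"
    by (rule Lim_transform_eventually[OF tendsto_const])
qed

text \<open>Local absolute continuity in integrated form, with \<open>g\<close> a representative of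
  the derivative. For continuous \<open>f\<close> it is equivalent to having the weak derivative
  \<open>g\<close> on the whole line, by \<open>has_ac_deriv_imp_weak\<close> and
  \<open>weak_imp_has_ac_deriv\<close>.\<close>

definition has_ac_deriv :: "(real \<Rightarrow> 'a::euclidean_space) \<Rightarrow> (real \<Rightarrow> 'a) \<Rightarrow> bool" where
  "has_ac_deriv f g \<longleftrightarrow> locally_integrable UNIV g \<and>
     (\<forall>x y. x \<le> y \<longrightarrow> (LBINT t:{x..y}. g t) = f y - f x)"

lemma has_ac_derivD:
  assumes "has_ac_deriv f g"
  shows "locally_integrable UNIV g" "x \<le> y \<Longrightarrow> (LBINT t:{x..y}. g t) = f y - f x"
    "x \<le> y \<Longrightarrow> (g has_integral (f y - f x)) {x..y}"
proof -
  show l: "locally_integrable UNIV g" and i: "x \<le> y \<Longrightarrow> (LBINT t:{x..y}. g t) = f y - f x" for x y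
    using assms by (auto simp: has_ac_deriv_def)
  assume "x \<le> y"
  moreover have "set_integrable lborel {x..y} g"
    using l by (rule locally_integrable_set) simp
  ultimately show "(g has_integral (f y - f x)) {x..y}"
    using i set_borel_integral_eq_integral by (metis integrable_integral)
qed

text \<open>Continuity excludes jumps at the exceptional points, so the fundamental theorem still
  holds. Functions given by formulas, including those with corners at \<open>0\<close> and
  \<open>\<plusminus>1\<close>, enter through this lemma.\<close>

lemma has_ac_deriv_piecewise:
  assumes "continuous_on UNIV f" "finite S" "\<And>x. x \<notin> S \<Longrightarrow> (f has_vector_derivative g x) (at x)"
    "locally_integrable UNIV g"
  shows "has_ac_deriv f g"
  unfolding has_ac_deriv_def
proof (intro conjI allI impI)
  fix x y :: real assume "x \<le> y"
  then have "(g has_integral (f y - f x)) {x..y}"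
    using assms by (intro fundamental_theorem_of_calculus_interior_strong[OF assms(2)])
      (auto intro: continuous_on_subset)
  moreover have "set_integrable lborel {x..y} g"
    using assms by (intro locally_integrable_set) auto
  ultimately show "(LBINT t:{x..y}. g t) = f y - f x"
    by (metis set_borel_integral_eq_integral(2) integral_unique)
qed fact

lemma has_ac_deriv_continuous:
  assumes "has_ac_deriv f g"
  shows "continuous_on A f"
proof -
  have "isCont f x" for x
  proof -
    have i: "g integrable_on {x-1..x+1}"
      using has_ac_derivD(3)[OF assms, of "x-1" "x+1"] by (auto simp: has_integral_integrable)
    have "continuous_on {x-1..x+1} (\<lambda>y. f (x-1) + integral {x-1..y} g)"
      by (intro continuous_intros indefinite_integral_continuous_1 i)
    moreover have "f (x-1) + integral {x-1..y} g = f y" if "y \<in> {x-1..x+1}" for y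
      using has_ac_derivD(3)[OF assms, of "x-1" y] that by (simp add: integral_unique)
    ultimately have "continuous_on {x-1..x+1} f"
      by (simp cong: continuous_on_cong_simp)
    then show ?thesis
      by (rule continuous_on_interior) simp
  qed
  then show ?thesis
    by (simp add: continuous_at_imp_continuous_on)
qed

text \<open>The way back to classical calculus: a derivative known only almost everywhere becomes
  pointwise wherever some representative of it is continuous.\<close>

lemma has_ac_deriv_imp_derivative:
  assumes f: "has_ac_deriv f g" and x: "isCont g x"
  shows "(f has_vector_derivative g x) (at x)"
proof -
  have "g integrable_on {x-1..x+1}"
    using has_ac_derivD(3)[OF f, of "x-1" "x+1"] by (auto simp: has_integral_integrable)
  then have "((\<lambda>y. integral {x-1..y} g) has_vector_derivative g x) (at x within {x-1..x+1} - {})"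
    by (rule integral_has_vector_derivative_continuous_at) (use x in \<open>auto intro: continuous_at_imp_continuous_at_within\<close>)
  then have "((\<lambda>y. integral {x-1..y} g) has_vector_derivative g x) (at x)"
    by (simp add: at_within_Icc_at)
  then have "((\<lambda>y. f (x-1) + integral {x-1..y} g) has_vector_derivative 0 + g x) (at x)"
    by (intro has_vector_derivative_add has_vector_derivative_const)
  moreover have "f (x-1) + integral {x-1..y} g = f y" if "y \<in> {x-1<..}" for y
    using has_ac_derivD(3)[OF f, of "x-1" y] that by (simp add: integral_unique)
  ultimately show ?thesis
    using has_vector_derivative_transform_within_open[of _ _ x "{x-1<..}" f] by simp
qed

lemma has_ac_deriv_cong_AE:
  assumes f: "has_ac_deriv f g" and gh: "AE x in lborel. g x = h x" and h: "h \<in> borel_measurable borel"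
  shows "has_ac_deriv f h"
proof -
  have m: "g \<in> borel_measurable borel"
    using has_ac_derivD(1)[OF f] by (rule locally_integrable_measurable)
  have *: "AE x in lborel. indicator K x *\<^sub>R g x = indicator K x *\<^sub>R h x" for K :: "real set"
    using gh by eventually_elim simp
  have "integrable lborel (\<lambda>x. indicator K x *\<^sub>R h x)" if "compact K" for K
  proof -
    have [measurable]: "K \<in> sets borel" "g \<in> borel_measurable borel" "h \<in> borel_measurable borel"
      using that m h by (auto intro: borel_compact)
    have "integrable lborel (\<lambda>x. indicator K x *\<^sub>R g x)"
      using has_ac_derivD(1)[OF f] that by (auto simp: locally_integrable_def set_integrable_def)
    then show ?thesis
      by (rule integrable_cong_AE_imp) (use * in \<open>auto elim!: eventually_mono\<close>)
  qed
  moreover have "(LBINT x:{p..q}. h x) = (LBINT x:{p..q}. g x)" for p q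
    unfolding set_lebesgue_integral_def using m h gh
    by (intro integral_cong_AE) (auto elim!: eventually_mono)
  ultimately show ?thesis
    using f by (auto simp: has_ac_deriv_def locally_integrable_def set_integrable_def)
qed

lemma has_ac_deriv_const: "has_ac_deriv (\<lambda>_. c) (\<lambda>_. 0)"
  by (rule has_ac_deriv_piecewise[where S = "{}"]) (auto intro: locally_integrable_continuous)

lemma has_ac_deriv_add:
  assumes f: "has_ac_deriv f f'" and g: "has_ac_deriv g g'"
  shows "has_ac_deriv (\<lambda>x. f x + g x) (\<lambda>x. f' x + g' x)"
  unfolding has_ac_deriv_def
  using f g locally_integrable_set[OF has_ac_derivD(1)[OF f]] locally_integrable_set[OF has_ac_derivD(1)[OF g]]
  by (auto simp: has_ac_deriv_def locally_integrable_add)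

lemma has_ac_deriv_exists:
  fixes g :: "real \<Rightarrow> 'a::euclidean_space"
  assumes "locally_integrable UNIV g"
  obtains f where "has_ac_deriv f g"
proof -
  have i: "g integrable_on {x..y}" for x y
    using set_borel_integral_eq_integral(1)[OF locally_integrable_set[OF assms]] by blast
  \<comment> \<open>For either sign of \<open>y\<close> one of the two integrals vanishes, so this
    is the signed integral from \<open>0\<close> to \<open>y\<close>.\<close>
  define f where "f y = integral {0..y} g - integral {y..0} g" for y
  have "(LBINT t:{x..y}. g t) = f y - f x" if "x \<le> y" for x y
  proof -
    have "integral {x..y} g = f y - f x"
    proof -
      consider "0 \<le> x" | "x < 0" "0 \<le> y" | "y < 0" by linarith
      then show ?thesis
      proof cases
        case 1
        have "integral {y..0} g = 0" "integral {x..0} g = 0"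
          using 1 that by (cases "y = 0"; cases "x = 0"; simp)+
        then show ?thesis
          using Henstock_Kurzweil_Integration.integral_combine[OF 1 that i] by (simp add: f_def algebra_simps)
      next
        case 2
        then have "integral {y..0} g = 0" "integral {0..x} g = 0"
          by (cases "y = 0"; simp)+
        then show ?thesis
          using Henstock_Kurzweil_Integration.integral_combine[OF _ _ i, of x 0 y] 2 by (simp add: f_def algebra_simps)
      next
        case 3
        then show ?thesis
          using Henstock_Kurzweil_Integration.integral_combine[OF _ _ i, of x y 0] that by (simp add: f_def algebra_simps)
      qed
    qed
    then show ?thesis
      using set_borel_integral_eq_integral(2)[OF locally_integrable_set[OF assms]] by simp
  qed
  then show thesis
    using assms by (intro that) (auto simp: has_ac_deriv_def)
qed

text \<open>Integration by parts, by exchanging the order of integration over the triangle \<open>s \<le> t\<close>.\<close>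

lemma has_ac_deriv_mult:
  fixes f g :: "real \<Rightarrow> real"
  assumes f: "has_ac_deriv f f'" and g: "has_ac_deriv g g'"
  shows "has_ac_deriv (\<lambda>x. f x * g x) (\<lambda>x. f' x * g x + f x * g' x)"
  unfolding has_ac_deriv_def
proof (intro conjI allI impI)
  have l: "locally_integrable UNIV (\<lambda>x. f' x * g x)" "locally_integrable UNIV (\<lambda>x. f x * g' x)"
    using has_ac_derivD(1)[OF f] has_ac_derivD(1)[OF g] has_ac_deriv_continuous[OF f] has_ac_deriv_continuous[OF g]
    by (auto intro: locally_integrable_mult_continuous)
  then show "locally_integrable UNIV (\<lambda>x. f' x * g x + f x * g' x)"
    by (rule locally_integrable_add)
  fix a b :: real assume ab: "a \<le> b"
  define F where "F s = indicator {a..b} s * f' s" for s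
  define G where "G t = indicator {a..b} t * g' t" for t
  have iF: "integrable lborel F" and iG: "integrable lborel G"
    using locally_integrable_set[OF has_ac_derivD(1)[OF f], of a b] locally_integrable_set[OF has_ac_derivD(1)[OF g], of a b]
    by (simp_all add: F_def[abs_def] G_def[abs_def] set_integrable_def)
  have [measurable]: "F \<in> borel_measurable borel" "G \<in> borel_measurable borel"
    using borel_measurable_integrable[OF iF] borel_measurable_integrable[OF iG] by simp_all
  define E where "E s t = (if s \<le> t then F s * G t else 0)" for s t
  have E1: "(LBINT t. E s t) = F s * (g b - g s)" for s
  proof (cases "s \<in> {a..b}")
    case True
    have "(LBINT t. E s t) = F s * (LBINT t:{s..b}. g' t)"
      using True unfolding set_lebesgue_integral_def integral_mult_right_zero[symmetric]
      by (intro Bochner_Integration.integral_cong) (auto simp: E_def G_def indicator_def)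
    then show ?thesis
      using has_ac_derivD(2)[OF g] True by auto
  qed (auto simp: E_def F_def cong: if_cong)
  have E2: "(LBINT s. E s t) = (f t - f a) * G t" for t
  proof (cases "t \<in> {a..b}")
    case True
    have "(LBINT s. E s t) = (LBINT s:{a..t}. f' s) * G t"
      using True unfolding set_lebesgue_integral_def integral_mult_left_zero[symmetric]
      by (intro Bochner_Integration.integral_cong) (auto simp: E_def F_def indicator_def)
    then show ?thesis
      using has_ac_derivD(2)[OF f] True by auto
  qed (auto simp: E_def G_def cong: if_cong)
  have "integrable (lborel \<Otimes>\<^sub>M lborel) (\<lambda>(s, t). F s * G t)"
  proof (rule lborel_pair.Fubini_integrable)
    show "integrable lborel (\<lambda>x. LBINT y. norm (case (x, y) of (s, t) \<Rightarrow> F s * G t))"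
      using iF iG by (simp add: abs_mult)
    show "AE x in lborel. integrable lborel (\<lambda>y. case (x, y) of (s, t) \<Rightarrow> F s * G t)"
      using iG by simp
  qed measurable
  then have "integrable (lborel \<Otimes>\<^sub>M lborel) (\<lambda>(s, t). E s t)"
    by (rule Bochner_Integration.integrable_bound) (auto simp: E_def)
  then have "(LBINT t. LBINT s. E s t) = (LBINT s. LBINT t. E s t)"
    by (rule lborel_pair.Fubini_integral)
  then have eq: "(LBINT t. (f t - f a) * G t) = (LBINT s. F s * (g b - g s))"
    by (simp add: E1 E2)
  have i1: "integrable lborel (\<lambda>t. f t * G t)" "integrable lborel (\<lambda>s. F s * g s)"
    using locally_integrable_set[OF l(1), of a b] locally_integrable_set[OF l(2), of a b]
    by (simp_all add: F_def G_def set_integrable_def mult_ac)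
  have FG: "(LBINT s. F s) = f b - f a" "(LBINT t. G t) = g b - g a"
    using has_ac_derivD(2)[OF f ab] has_ac_derivD(2)[OF g ab]
    by (simp_all add: set_lebesgue_integral_def F_def G_def)
  have "(LBINT t. f t * G t) - f a * (g b - g a) = (f b - f a) * g b - (LBINT s. F s * g s)"
    using eq iF iG i1 by (simp add: left_diff_distrib right_diff_distrib FG)
  then have "(LBINT s. F s * g s) + (LBINT t. f t * G t) = f b * g b - f a * g a"
    by (simp add: algebra_simps)
  moreover have "(LBINT t:{a..b}. f' t * g t + f t * g' t) = (LBINT s. F s * g s + f s * G s)"
    unfolding set_lebesgue_integral_def by (intro Bochner_Integration.integral_cong) (auto simp: F_def G_def algebra_simps)
  ultimately show "(LBINT t:{a..b}. f' t * g t + f t * g' t) = f b * g b - f a * g a"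
    using i1 by simp
qed

lemma smooth_has_ac_deriv: "smooth \<psi> \<Longrightarrow> has_ac_deriv \<psi> (deriv \<psi>)"
  by (rule has_ac_deriv_piecewise[where S = "{}"])
    (auto simp: smooth_continuous smooth_deriv has_real_derivative_iff_has_vector_derivative[symmetric]
      intro: smooth_has_deriv locally_integrable_continuous)

lemma has_ac_deriv_test:
  fixes f :: "real \<Rightarrow> real"
  assumes f: "has_ac_deriv f g" and \<psi>: "test_function UNIV \<psi>"
  shows "(LBINT x. deriv \<psi> x * f x) = - (LBINT x. \<psi> x * g x)"
proof -
  obtain p q where pq: "p \<le> q" "\<And>x. x \<notin> {p..q} \<Longrightarrow> \<psi> x = 0"
    using test_function_interval[OF \<psi>] by auto
  have d: "deriv \<psi> x = 0" if "x \<notin> {p..q}" for x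
    using deriv_outside_closed[of "{p..q}"] pq that by auto
  have "smooth \<psi>" using \<psi> by (simp add: test_function_smooth)
  \<comment> \<open>Widening by \<open>1\<close> on both sides puts the end points outside the
    support, which removes the boundary terms.\<close>
  then have "(LBINT x:{p-1..q+1}. deriv \<psi> x * f x + \<psi> x * g x) = \<psi> (q+1) * f (q+1) - \<psi> (p-1) * f (p-1)"
    using has_ac_derivD(2)[OF has_ac_deriv_mult[OF smooth_has_ac_deriv f]] pq(1) by auto
  also have "\<dots> = 0" using pq by simp
  also have "(LBINT x:{p-1..q+1}. deriv \<psi> x * f x + \<psi> x * g x) = (LBINT x. deriv \<psi> x * f x + \<psi> x * g x)"
    unfolding set_lebesgue_integral_def
  proof (rule Bochner_Integration.integral_cong)
    show "indicat_real {p-1..q+1} x *\<^sub>R (deriv \<psi> x * f x + \<psi> x * g x) = deriv \<psi> x * f x + \<psi> x * g x" for x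
      by (cases "x \<in> {p..q}") (auto simp: d pq(2))
  qed simp
  finally show ?thesis
    using integrable_times_test[OF locally_integrable_continuous[OF has_ac_deriv_continuous[OF f]] test_function_deriv[OF \<psi>]]
      integrable_times_test[OF has_ac_derivD(1)[OF f] \<psi>]
    by simp
qed

lemma has_ac_deriv_componentwise:
  "has_ac_deriv f g \<longleftrightarrow> (\<forall>b\<in>Basis. has_ac_deriv (\<lambda>x. f x \<bullet> b) (\<lambda>x. g x \<bullet> b))"
proof safe
  fix b :: 'a
  assume "has_ac_deriv f g"
  note * = has_ac_derivD[OF this]
  show "has_ac_deriv (\<lambda>x. f x \<bullet> b) (\<lambda>x. g x \<bullet> b)"
    unfolding has_ac_deriv_def
  proof (intro conjI allI impI)
    fix x y :: real assume xy: "x \<le> y"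
    have i: "integrable lborel (\<lambda>t. indicator {x..y} t *\<^sub>R g t)"
      using locally_integrable_set[OF *(1)] by (simp add: set_integrable_def)
    show "(LBINT t:{x..y}. g t \<bullet> b) = f y \<bullet> b - f x \<bullet> b"
      using *(2)[OF xy] integral_inner_left[OF i, of b]
      by (simp add: set_lebesgue_integral_def inner_diff_left)
  qed (intro locally_integrable_inner *)
next
  assume a: "\<forall>b\<in>Basis. has_ac_deriv (\<lambda>x. f x \<bullet> b) (\<lambda>x. g x \<bullet> b)"
  have i: "integrable lborel (\<lambda>t. indicator K t *\<^sub>R g t)" if "compact K" for K
  proof -
    have "integrable lborel (\<lambda>t. \<Sum>b\<in>Basis. (indicator K t * (g t \<bullet> b)) *\<^sub>R b)"
    proof (intro Bochner_Integration.integrable_sum integrable_scaleR_left)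
      fix b :: 'a assume "b \<in> Basis"
      then have "locally_integrable UNIV (\<lambda>x. g x \<bullet> b)"
        using a has_ac_derivD(1) by blast
      then show "integrable lborel (\<lambda>t. indicat_real K t * (g t \<bullet> b))"
        using that by (auto simp: locally_integrable_def set_integrable_def)
    qed
    moreover have "(\<Sum>b\<in>Basis. (indicator K t * (g t \<bullet> b)) *\<^sub>R b) = indicator K t *\<^sub>R g t" for t
      by (simp add: scaleR_sum_right[symmetric] scaleR_scaleR[symmetric] euclidean_representation del: scaleR_scaleR)
    ultimately show ?thesis by simp
  qed
  show "has_ac_deriv f g"
    unfolding has_ac_deriv_def
  proof (intro conjI allI impI)
    show "locally_integrable UNIV g"
      using i by (simp add: locally_integrable_def set_integrable_def)
    fix x y :: real assume xy: "x \<le> y"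
    show "(LBINT t:{x..y}. g t) = f y - f x"
    proof (rule euclidean_eqI)
      fix b :: 'a assume "b \<in> Basis"
      then have "(LBINT t:{x..y}. g t \<bullet> b) = f y \<bullet> b - f x \<bullet> b"
        using a has_ac_derivD(2) xy by blast
      then show "(LBINT t:{x..y}. g t) \<bullet> b = (f y - f x) \<bullet> b"
        using integral_inner_left[OF i[of "{x..y}"], of b]
        by (simp add: set_lebesgue_integral_def inner_diff_left)
    qed
  qed
qed

lemma has_ac_deriv_nth_iff:
  fixes f g :: "real \<Rightarrow> real^'n"
  shows "has_ac_deriv f g \<longleftrightarrow> (\<forall>i. has_ac_deriv (\<lambda>x. f x $ i) (\<lambda>x. g x $ i))"
  unfolding has_ac_deriv_componentwise[of f]
  by (auto simp: Basis_vec_def inner_axis)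

lemma has_ac_deriv_imp_weak:
  assumes "has_ac_deriv f g"
  shows "has_weak_deriv UNIV f g"
  unfolding has_weak_deriv_def
proof (intro conjI allI impI)
  show f: "locally_integrable UNIV f"
    by (intro locally_integrable_continuous has_ac_deriv_continuous[OF assms])
  show g: "locally_integrable UNIV g"
    using assms has_ac_derivD by blast
  fix \<psi> assume \<psi>: "test_function UNIV \<psi>"
  show "(LBINT x. deriv \<psi> x *\<^sub>R f x) = - (LBINT x. \<psi> x *\<^sub>R g x)"
  proof (rule euclidean_eqI)
    fix b :: 'a assume "b \<in> Basis"
    then have "has_ac_deriv (\<lambda>x. f x \<bullet> b) (\<lambda>x. g x \<bullet> b)"
      using assms has_ac_deriv_componentwise by blast
    from has_ac_deriv_test[OF this \<psi>]
    show "(LBINT x. deriv \<psi> x *\<^sub>R f x) \<bullet> b = - (LBINT x. \<psi> x *\<^sub>R g x) \<bullet> b"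
      using integral_inner_left[OF integrable_times_test[OF f test_function_deriv[OF \<psi>]], of b]
        integral_inner_left[OF integrable_times_test[OF g \<psi>], of b]
      by simp
  qed
qed

section \<open>From weak derivatives to primitives\<close>

lemma antiderivative_test_function:
  assumes U: "is_interval U" "U \<noteq> {}" and \<xi>: "test_function U \<xi>" "(LBINT x. \<xi> x) = 0"
  obtains \<theta> where "test_function U \<theta>" "deriv \<theta> = \<xi>"
proof -
  have s: "smooth \<xi>" using \<xi> by (simp add: test_function_smooth)
  obtain p q where pq: "p \<le> q" "{p..q} \<subseteq> U" "\<And>x. x \<notin> {p..q} \<Longrightarrow> \<xi> x = 0"
    using test_function_interval[OF \<xi>(1) U] by metis
  obtain F where F: "has_ac_deriv F \<xi>"
    using has_ac_deriv_exists locally_integrable_continuous smooth_continuous s by metis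
  define \<theta> where "\<theta> x = F x - F p" for x
  have dF: "(F has_real_derivative \<xi> x) (at x)" for x
    using has_ac_deriv_imp_derivative[OF F] smooth_continuous[OF s, of UNIV]
    by (simp add: has_real_derivative_iff_has_vector_derivative continuous_on_eq_continuous_at)
  have d\<theta>: "(\<theta> has_real_derivative \<xi> x) (at x)" for x
    unfolding \<theta>_def using dF by (auto intro!: derivative_eq_intros)
  \<comment> \<open>Left of the support the primitive based at \<open>p\<close> is still
    \<open>0\<close>; right of it, it has collected the full integral, which is \<open>0\<close> as
    well.\<close>
  have z: "\<theta> x = 0" if "x \<notin> {p..q}" for x
  proof (cases "x < p")
    case True
    have "(LBINT t:{x..p}. \<xi> t) = 0"
    proof -
      have "(LBINT t:{x..p}. \<xi> t) = (LBINT t:{x..p}. 0)"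
        unfolding set_lebesgue_integral_def
      proof (rule integral_cong_AE)
        show "AE t in lborel. indicat_real {x..p} t *\<^sub>R \<xi> t = indicat_real {x..p} t *\<^sub>R 0"
          using AE_lborel_singleton[of p]
        proof eventually_elim
          case (elim t)
          then show ?case
            by (cases "t \<in> {p..q}") (auto simp: pq(3) indicator_def)
        qed
      qed (use smooth_measurable[OF s] in auto)
      then show ?thesis by simp
    qed
    then show ?thesis
      using has_ac_derivD(2)[OF F, of x p] True by (simp add: \<theta>_def)
  next
    case False
    then have "x > q" using that by auto
    have "(LBINT t:{p..x}. \<xi> t) = (LBINT t. \<xi> t)"
      unfolding set_lebesgue_integral_def
    proof (rule Bochner_Integration.integral_cong)
      show "indicat_real {p..x} t *\<^sub>R \<xi> t = \<xi> t" for t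
        using \<open>x > q\<close> by (cases "t \<in> {p..q}") (auto simp: pq(3))
    qed simp
    then show ?thesis
      using has_ac_derivD(2)[OF F, of p x] \<open>x > q\<close> pq(1) \<xi>(2) by (simp add: \<theta>_def)
  qed
  show thesis
  proof (rule that)
    show "deriv \<theta> = \<xi>" using d\<theta> DERIV_imp_deriv by blast
    have "smooth \<theta>" using d\<theta> s by (rule smoothI)
    then show "test_function U \<theta>"
      unfolding test_function_smooth using z pq(2) compact_Icc by metis
  qed
qed

text \<open>Every test function differs by a multiple of a fixed bump from one with integral \<open>0\<close>, that is,
  from the derivative of a test function.\<close>

lemma du_Bois_Reymond:
  fixes h :: "real \<Rightarrow> real"
  assumes U: "open U" "is_interval U" "U \<noteq> {}" and h: "locally_integrable U h"
    and z: "\<And>\<psi>. test_function U \<psi> \<Longrightarrow> (LBINT x. deriv \<psi> x * h x) = 0"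
  obtains c where "AE x in lborel. x \<in> U \<longrightarrow> h x = c"
proof -
  obtain x e where "e > 0" "cball x e \<subseteq> U"
    using U open_contains_cball by blast
  then obtain p q where pq: "p < q" "{p..q} \<subseteq> U"
    by (metis add_strict_left_mono cball_eq_atLeastAtMost diff_less_eq less_add_same_cancel1 less_trans)
  define \<beta> where "\<beta> = bump p q 0"
  have \<beta>: "test_function U \<beta>"
    using test_function_bump pq by (simp add: \<beta>_def)
  have i\<beta>: "integrable lborel \<psi>" if "test_function U \<psi>" for \<psi>
    using integrable_times_test[OF locally_integrable_continuous[of "\<lambda>_. 1::real"] test_function_mono[OF that]] by simp
  define I where "I = (LBINT x. \<beta> x)"
  have "I \<noteq> 0"
  proof
    assume "I = 0"
    then have "AE x in lborel. \<beta> x = 0"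
      using integral_nonneg_eq_0_iff_AE[OF i\<beta>[OF \<beta>]] bump_nonneg by (simp add: I_def \<beta>_def)
    then have "AE x in lborel. x \<notin> {p<..<q}"
      by eventually_elim (use bump_pos[of _ p q 0] in \<open>force simp: \<beta>_def\<close>)
    then have "emeasure lborel {p<..<q} = 0"
      by (intro null_setsD1 AE_iff_null_sets[THEN iffD2]) auto
    then show False using pq by simp
  qed
  define c where "c = (LBINT x. \<beta> x * h x) / I"
  have "AE x in lborel. x \<in> U \<longrightarrow> h x - c = 0"
  proof (rule fundamental_lemma[OF U(1)])
    have "locally_integrable U (\<lambda>_. c)"
      using locally_integrable_mono[OF locally_integrable_continuous[of "\<lambda>_. c"]] by simp
    then show "locally_integrable U (\<lambda>x. h x - c)"
      using h by (rule locally_integrable_diff[rotated])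
    fix \<psi> assume \<psi>: "test_function U \<psi>"
    define k where "k = (LBINT x. \<psi> x) / I"
    define \<xi> where "\<xi> x = 1 * \<psi> x + (- k) * \<beta> x" for x
    have "test_function U \<xi>"
    proof -
      obtain K L where "compact K" "K \<subseteq> U" "\<And>x. x \<notin> K \<Longrightarrow> \<psi> x = 0" "compact L" "L \<subseteq> U" "\<And>x. x \<notin> L \<Longrightarrow> \<beta> x = 0"
        using \<psi> \<beta> by (auto simp: test_function_def)
      moreover have "smooth \<xi>"
        unfolding \<xi>_def using \<psi> \<beta> by (intro smooth_linear_combination) (auto simp: test_function_smooth)
      ultimately show ?thesis
        unfolding test_function_smooth by (intro conjI exI[of _ "K \<union> L"]) (auto simp: \<xi>_def)
    qed
    moreover have "(LBINT x. \<xi> x) = 0"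
      using i\<beta>[OF \<psi>] i\<beta>[OF \<beta>] \<open>I \<noteq> 0\<close> by (simp add: \<xi>_def k_def I_def[symmetric])
    ultimately obtain \<theta> where "test_function U \<theta>" "deriv \<theta> = \<xi>"
      using antiderivative_test_function[OF U(2,3)] by blast
    then have "(LBINT x. \<xi> x * h x) = 0"
      using z by blast
    moreover have "integrable lborel (\<lambda>x. \<psi> x * h x)" "integrable lborel (\<lambda>x. \<beta> x * h x)"
      using integrable_times_test[OF h \<psi>] integrable_times_test[OF h \<beta>] by simp_all
    ultimately have "(LBINT x. \<psi> x * h x) - k * (LBINT x. \<beta> x * h x) = 0"
      by (simp add: \<xi>_def algebra_simps)
    moreover have "k * (LBINT x. \<beta> x * h x) = (LBINT x. \<psi> x) * c"
      by (simp add: k_def c_def)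
    ultimately show "(LBINT x. \<psi> x * (h x - c)) = 0"
      using integrable_times_test[OF h \<psi>] i\<beta>[OF \<psi>] by (simp add: right_diff_distrib)
  qed
  then show thesis
    by (intro that[of c]) auto
qed

text \<open>The difference \<open>f - W\<close> has weak derivative \<open>0\<close> on
  \<open>U\<close>, so \<open>du_Bois_Reymond\<close> makes it constant there. \<open>U\<close> must
  be connected, whereas \<open>V\<close> carries the equation: on the punctured line each half line
  receives its own constant.\<close>

lemma weak_deriv_eq_primitive:
  fixes f :: "real \<Rightarrow> real"
  assumes U: "open U" "is_interval U" "U \<noteq> {}" "U \<subseteq> V" and f: "has_weak_deriv V f g" and W: "has_ac_deriv W g"
  obtains c where "AE x in lborel. x \<in> U \<longrightarrow> f x = c + W x"
proof -
  have lW: "locally_integrable U W"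
    using W by (intro locally_integrable_mono[OF locally_integrable_continuous] has_ac_deriv_continuous) auto
  have lf: "locally_integrable U f"
    using f U locally_integrable_mono by (auto simp: has_weak_deriv_def)
  have "(LBINT x. deriv \<psi> x * (f x - W x)) = 0" if \<psi>: "test_function U \<psi>" for \<psi>
  proof -
    have "(LBINT x. deriv \<psi> x * f x) = - (LBINT x. \<psi> x * g x)"
      using f test_function_mono[OF \<psi> U(4)] by (auto simp: has_weak_deriv_def)
    moreover have "(LBINT x. deriv \<psi> x * W x) = - (LBINT x. \<psi> x * g x)"
      using has_ac_deriv_test[OF W test_function_mono[OF \<psi>]] by simp
    ultimately show ?thesis
      using integrable_times_test[OF lf test_function_deriv[OF \<psi>]] integrable_times_test[OF lW test_function_deriv[OF \<psi>]]
      by (simp add: right_diff_distrib)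
  qed
  then obtain c where "AE x in lborel. x \<in> U \<longrightarrow> f x - W x = c"
    using du_Bois_Reymond[OF U(1-3) locally_integrable_diff[OF lf lW]] by blast
  then show thesis
    by (intro that[of c]) (auto elim!: eventually_mono)
qed

lemma AE_eq_continuous:
  fixes f g :: "real \<Rightarrow> real"
  assumes "continuous_on UNIV f" "continuous_on UNIV g" "open U" "AE x in lborel. x \<in> U \<longrightarrow> f x = g x" "x \<in> U"
  shows "f x = g x"
proof -
  have "x \<in> {x. f x = g x}"
  proof (rule mem_closed_if_AE_lebesgue_open)
    show "closed {x. f x = g x}"
      using assms by (intro closed_Collect_eq)
    show "AE x\<in>U in lebesgue. x \<in> {x. f x = g x}"
      using AE_completion[OF assms(4)] by simp
  qed fact+
  then show ?thesis by simp
qed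

text \<open>Each component of \<open>f\<close> equals a primitive almost everywhere up to a
  constant, and by continuity the equality holds at every point.\<close>

lemma weak_imp_has_ac_deriv:
  assumes "continuous_on UNIV f" "has_weak_deriv UNIV f g"
  shows "has_ac_deriv f g"
proof (subst has_ac_deriv_componentwise, intro ballI)
  fix b :: 'a assume b: "b \<in> Basis"
  have lf: "locally_integrable UNIV f" and lg: "locally_integrable UNIV g"
    using assms by (auto simp: has_weak_deriv_def)
  have w: "has_weak_deriv UNIV (\<lambda>x. f x \<bullet> b) (\<lambda>x. g x \<bullet> b)"
    unfolding has_weak_deriv_def
  proof (intro conjI allI impI locally_integrable_inner lf lg)
    fix \<psi> assume \<psi>: "test_function UNIV \<psi>"
    then have "(LBINT x. deriv \<psi> x *\<^sub>R f x) \<bullet> b = - (LBINT x. \<psi> x *\<^sub>R g x) \<bullet> b"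
      using assms by (auto simp: has_weak_deriv_def)
    then show "(LBINT x. deriv \<psi> x *\<^sub>R (f x \<bullet> b)) = - (LBINT x. \<psi> x *\<^sub>R (g x \<bullet> b))"
      using integral_inner_left[OF integrable_times_test[OF lf test_function_deriv[OF \<psi>]], of b]
        integral_inner_left[OF integrable_times_test[OF lg \<psi>], of b]
      by simp
  qed
  obtain W where W: "has_ac_deriv W (\<lambda>x. g x \<bullet> b)"
    using has_ac_deriv_exists[OF locally_integrable_inner[OF lg]] by blast
  obtain c where c: "AE x in lborel. x \<in> UNIV \<longrightarrow> f x \<bullet> b = c + W x"
    by (rule weak_deriv_eq_primitive[OF _ _ _ _ w W, of UNIV]) auto
  have "f x \<bullet> b = c + W x" for x
    by (rule AE_eq_continuous[OF _ _ _ c])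
      (auto intro!: continuous_intros assms has_ac_deriv_continuous[OF W])
  then show "has_ac_deriv (\<lambda>x. f x \<bullet> b) (\<lambda>x. g x \<bullet> b)"
    using W by (simp add: has_ac_deriv_def)
qed

lemma has_ac_deriv_unique:
  assumes "has_ac_deriv f g" "has_ac_deriv f h"
  shows "AE x in lborel. g x = h x"
proof -
  have "AE x in lborel. \<forall>b\<in>Basis. g x \<bullet> b = h x \<bullet> b"
  proof (rule AE_finite_allI[OF finite_Basis])
    fix b :: 'a assume "b \<in> Basis"
    then have gh: "has_ac_deriv (\<lambda>x. f x \<bullet> b) (\<lambda>x. g x \<bullet> b)" "has_ac_deriv (\<lambda>x. f x \<bullet> b) (\<lambda>x. h x \<bullet> b)"
      using assms has_ac_deriv_componentwise by blast+
    have "AE x in lborel. x \<in> UNIV \<longrightarrow> g x \<bullet> b - h x \<bullet> b = 0"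
    proof (rule AE_zero_of_interval_integrals)
      fix p q :: real
      show "(LBINT x:{p..q}. g x \<bullet> b - h x \<bullet> b) = 0"
        using has_ac_derivD(2)[OF gh(1), of p q] has_ac_derivD(2)[OF gh(2), of p q]
          locally_integrable_set[OF has_ac_derivD(1)[OF gh(1)], of p q]
          locally_integrable_set[OF has_ac_derivD(1)[OF gh(2)], of p q]
        by (cases "p \<le> q") (auto simp: set_lebesgue_integral_def[of _ "{}"])
    qed (intro open_UNIV locally_integrable_diff has_ac_derivD(1)[OF gh(1)] has_ac_derivD(1)[OF gh(2)])+
    then show "AE x in lborel. g x \<bullet> b = h x \<bullet> b"
      by simp
  qed
  then show ?thesis
    by eventually_elim (auto intro: euclidean_eqI)
qed

section \<open>The Sobolev spaces in terms of primitives\<close>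

lemma H1_loc_has_ac_deriv: "f \<in> H1_loc \<Longrightarrow> has_ac_deriv f (weak_deriv f)"
  unfolding H1_loc_def weak_deriv_def
  by (auto intro!: weak_imp_has_ac_deriv intro: someI[where P = "has_weak_deriv UNIV f"])

text \<open>\<open>weak_deriv\<close> is a \<open>SOME\<close> choice: one candidate ensures that
  the choice is a genuine weak derivative, and uniqueness identifies it with the candidate almost
  everywhere.\<close>

lemma weak_deriv_eq:
  assumes "has_ac_deriv f g"
  shows "has_ac_deriv f (weak_deriv f)" "AE x in lborel. weak_deriv f x = g x"
proof -
  have "has_weak_deriv UNIV f (weak_deriv f)"
    unfolding weak_deriv_def by (rule someI[where P = "has_weak_deriv UNIV f", OF has_ac_deriv_imp_weak[OF assms]])
  then show *: "has_ac_deriv f (weak_deriv f)"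
    by (intro weak_imp_has_ac_deriv has_ac_deriv_continuous[OF assms])
  show "AE x in lborel. weak_deriv f x = g x"
    by (rule has_ac_deriv_unique[OF * assms])
qed

lemma H1_locI:
  assumes "has_ac_deriv f g" "locally_integrable UNIV (\<lambda>x. (norm (g x))\<^sup>2)"
  shows "f \<in> H1_loc"
  using assms has_ac_deriv_imp_weak has_ac_deriv_continuous by (auto simp: H1_loc_def)

lemma H1I:
  assumes f: "has_ac_deriv f g" and g: "integrable lborel (\<lambda>x. (norm (g x))\<^sup>2)"
    and f2: "integrable lborel (\<lambda>x. (norm (f x))\<^sup>2)"
  shows "f \<in> H1"
proof -
  have m: "f \<in> borel_measurable borel" "weak_deriv f \<in> borel_measurable borel" "g \<in> borel_measurable borel"
    using has_ac_deriv_continuous[OF f] has_ac_derivD(1)[OF weak_deriv_eq(1)[OF f]] has_ac_derivD(1)[OF f]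
    by (auto intro: borel_measurable_continuous_onI locally_integrable_measurable)
  have "integrable lborel (\<lambda>x. (norm (weak_deriv f x))\<^sup>2)"
  proof (subst integrable_cong_AE)
    show "AE x in lborel. (norm (weak_deriv f x))\<^sup>2 = (norm (g x))\<^sup>2"
      using weak_deriv_eq(2)[OF f] by eventually_elim simp
  qed (use m g in auto)
  moreover have "f \<in> H1_loc"
  proof (rule H1_locI[OF f])
    show "locally_integrable UNIV (\<lambda>x. (norm (g x))\<^sup>2)"
      unfolding locally_integrable_def set_integrable_def
      using integrable_mult_indicator[OF _ g] by (simp add: borel_compact)
  qed
  ultimately show ?thesis
    using m f2 by (simp add: H1_def L2_def)
qed

section \<open>Nonexistence of minimizers\<close>

lemma norm_vec3: "(norm (v :: real^3))\<^sup>2 = (v $ 1)\<^sup>2 + (v $ 2)\<^sup>2 + (v $ 3)\<^sup>2"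
  unfolding power2_norm_eq_inner inner_vec_def by (simp add: sum_3 power2_eq_square)

lemma tendsto_vec3_iff:
  fixes f :: "'a \<Rightarrow> real^3"
  shows "(f \<longlongrightarrow> l) F \<longleftrightarrow> ((\<lambda>x. f x $ 1) \<longlongrightarrow> l $ 1) F \<and> ((\<lambda>x. f x $ 2) \<longlongrightarrow> l $ 2) F \<and> ((\<lambda>x. f x $ 3) \<longlongrightarrow> l $ 3) F"
proof
  assume "((\<lambda>x. f x $ 1) \<longlongrightarrow> l $ 1) F \<and> ((\<lambda>x. f x $ 2) \<longlongrightarrow> l $ 2) F \<and> ((\<lambda>x. f x $ 3) \<longlongrightarrow> l $ 3) F"
  then have "((\<lambda>x. f x $ i) \<longlongrightarrow> l $ i) F" for i
    using exhaust_3[of i] by auto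
  then show "(f \<longlongrightarrow> l) F"
    by (rule vec_tendstoI)
qed (simp add: tendsto_vec_nth)

lemma has_ac_deriv_vec3:
  assumes "has_ac_deriv f1 g1" "has_ac_deriv f2 g2" "has_ac_deriv f3 g3"
  shows "has_ac_deriv (\<lambda>x. vector [f1 x, f2 x, f3 x] :: real^3) (\<lambda>x. vector [g1 x, g2 x, g3 x])"
  using assms by (simp add: has_ac_deriv_nth_iff forall_3)

text \<open>Differentiate \<open>|m|^2 = 1\<close> by the product rule: the constant function has
  both \<open>?h\<close> and \<open>0\<close> as derivative, so they agree almost
  everywhere.\<close>

lemma sphere_deriv_orthogonal:
  fixes m :: "real \<Rightarrow> real^3"
  assumes m: "has_ac_deriv m g" and n: "\<And>x. norm (m x) = 1"
  shows "AE x in lborel. m x $ 1 * g x $ 1 + m x $ 2 * g x $ 2 + m x $ 3 * g x $ 3 = 0"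
proof -
  have c: "has_ac_deriv (\<lambda>x. m x $ i) (\<lambda>x. g x $ i)" for i
    using m has_ac_deriv_nth_iff by blast
  have "has_ac_deriv (\<lambda>x. m x $ 1 * m x $ 1 + m x $ 2 * m x $ 2 + m x $ 3 * m x $ 3)
      (\<lambda>x. (g x $ 1 * m x $ 1 + m x $ 1 * g x $ 1) + (g x $ 2 * m x $ 2 + m x $ 2 * g x $ 2)
        + (g x $ 3 * m x $ 3 + m x $ 3 * g x $ 3))" (is "has_ac_deriv _ ?h")
    by (intro has_ac_deriv_add has_ac_deriv_mult c)
  moreover have "m x $ 1 * m x $ 1 + m x $ 2 * m x $ 2 + m x $ 3 * m x $ 3 = 1" for x
    using norm_vec3[of "m x"] n[of x] by (simp add: power2_eq_square)
  ultimately have "has_ac_deriv (\<lambda>_. 1) ?h" by simp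
  then have "AE x in lborel. ?h x = 0"
    by (rule has_ac_deriv_unique) (rule has_ac_deriv_const)
  then show ?thesis
    by eventually_elim (simp add: mult.commute)
qed

text \<open>Cauchy-Schwarz for a tangent vector \<open>(p, q, r)\<close> at the point
  \<open>(u, y, z)\<close> of the sphere: its first component is its product with the tangential
  part of the first basis vector, whose squared length is \<open>1 - u^2 = y^2 + z^2\<close>. The
  proof uses Lagrange's identity for the other two components.\<close>

lemma orthogonal_component_bound:
  fixes u y z p q r :: real
  assumes "u\<^sup>2 + y\<^sup>2 + z\<^sup>2 = 1" "u * p + y * q + z * r = 0"
  shows "p\<^sup>2 \<le> (p\<^sup>2 + q\<^sup>2 + r\<^sup>2) * (y\<^sup>2 + z\<^sup>2)"
proof -
  have "(u * p)\<^sup>2 = (y * q + z * r)\<^sup>2"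
    using assms(2) by (metis add.assoc eq_neg_iff_add_eq_0 power2_minus)
  moreover have "(y * q + z * r)\<^sup>2 + (y * r - z * q)\<^sup>2 = (y\<^sup>2 + z\<^sup>2) * (q\<^sup>2 + r\<^sup>2)"
    by algebra
  ultimately have "u\<^sup>2 * p\<^sup>2 \<le> (y\<^sup>2 + z\<^sup>2) * (q\<^sup>2 + r\<^sup>2)"
    using zero_le_power2[of "y * r - z * q"] by (simp only: power_mult_distrib)
  moreover have "p\<^sup>2 = u\<^sup>2 * p\<^sup>2 + (y\<^sup>2 + z\<^sup>2) * p\<^sup>2"
    using assms(1) by (metis add.assoc distrib_right mult_1)
  ultimately show ?thesis
    by (simp add: algebra_simps)
qed

text \<open>Equality throughout \<open>2 p \<le> 2 sqrt (G s) \<le> G + s \<le> a (G + s)\<close>: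
  the middle step forces \<open>G = s\<close>, and the last one forces \<open>G + s = 0\<close> when
  \<open>a > 1\<close>.\<close>

lemma equality_case:
  fixes G s p a :: real
  assumes "p\<^sup>2 \<le> G * s" "G \<ge> 0" "s \<ge> 0" "a \<ge> 1" "a * G + a * s = 2 * p"
  shows "p = s" "a > 1 \<Longrightarrow> s = 0"
proof -
  have G: "G + s \<le> a * (G + s)"
    using assms mult_right_mono[of 1 a "G + s"] by simp
  have "(2 * p)\<^sup>2 \<le> 4 * (G * s)"
    using assms(1) by (simp add: power_mult_distrib)
  moreover have "(G + s)\<^sup>2 \<le> (2 * p)\<^sup>2"
    using G assms by (intro power_mono) (auto simp: distrib_left)
  moreover have "(G + s)\<^sup>2 = 4 * (G * s) + (G - s)\<^sup>2"
    by (simp add: power2_eq_square algebra_simps)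
  ultimately have "(G - s)\<^sup>2 \<le> 0" by linarith
  then have [simp]: "G = s" by simp
  have "p\<^sup>2 \<le> s\<^sup>2" using assms by (simp add: power2_eq_square)
  then have "p \<le> s" using assms by (simp add: abs_le_square_iff[symmetric])
  then show "p = s" using G assms by simp
  then have "a * s = s" using assms by simp
  then show "a > 1 \<Longrightarrow> s = 0" by simp
qed

lemma inverse_cosh_square: "(1 / cosh (x::real))\<^sup>2 = 1 - (tanh x)\<^sup>2"
proof -
  have "cosh x \<noteq> 0"
    by simp
  then show ?thesis
    by (simp add: tanh_def power_divide sinh_square_eq field_simps)
qed

section \<open>The layered weight and its competitors\<close>

locale layer =
  fixes a :: "real \<Rightarrow> real"
  assumes inside: "\<And>x. x \<in> {-1<..<1} \<Longrightarrow> a x = 2"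
    and outside: "\<And>x. x \<notin> {-1..1} \<Longrightarrow> a x = 1"
begin

lemma measurable_weight [measurable]: "a \<in> borel_measurable borel"
proof -
  have "a = (\<lambda>x. if x \<in> {-1<..<1} then 2 else if x = 1 then a 1 else if x = -1 then a (-1) else 1)"
    using inside outside by (force simp: fun_eq_iff)
  then show ?thesis
    by (rule ssubst) measurable
qed

lemma AE_weight: "AE x in lborel. (x \<in> {-1<..<1} \<and> a x = 2) \<or> (x \<notin> {-1..1} \<and> a x = 1)"
  using AE_lborel_singleton[of "-1"] AE_lborel_singleton[of 1]
  by eventually_elim (use inside outside in force)

text \<open>The optimal profile for the constant weight \<open>1\<close>, placed far from the layer.\<close>

definition shifted_profile :: "real \<Rightarrow> real \<Rightarrow> real^3" where
  "shifted_profile R x = vector [tanh (x - R), 1 / cosh (x - R), 0]"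

lemma shifted_profile_ac:
  "has_ac_deriv (shifted_profile R)
     (\<lambda>x. vector [1 - (tanh (x - R))\<^sup>2, - tanh (x - R) * (1 / cosh (x - R)), 0])"
proof -
  have nz: "cosh x \<noteq> 0" for x :: real
    by simp
  have c: "continuous_on UNIV (\<lambda>x. tanh (x - R))" "continuous_on UNIV (\<lambda>x. 1 / cosh (x - R))"
    using nz by (auto intro!: continuous_intros)
  show ?thesis
    unfolding shifted_profile_def
  proof (intro has_ac_deriv_vec3 has_ac_deriv_const)
    show "has_ac_deriv (\<lambda>x. tanh (x - R)) (\<lambda>x. 1 - (tanh (x - R))\<^sup>2)"
      using nz
      by (intro has_ac_deriv_piecewise[where S = "{}"] locally_integrable_continuous c continuous_intros)
        (auto intro!: derivative_eq_intros simp flip: has_real_derivative_iff_has_vector_derivative)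
    show "has_ac_deriv (\<lambda>x. 1 / cosh (x - R)) (\<lambda>x. - tanh (x - R) * (1 / cosh (x - R)))"
      using nz
      by (intro has_ac_deriv_piecewise[where S = "{}"] locally_integrable_continuous c continuous_intros)
        (auto intro!: derivative_eq_intros simp: tanh_def simp flip: has_real_derivative_iff_has_vector_derivative)
  qed
qed

lemma tanh_shift_limits:
  "((\<lambda>x. tanh (x - R)) \<longlongrightarrow> (1::real)) at_top" "((\<lambda>x. tanh (x - R)) \<longlongrightarrow> (-1::real)) at_bot"
proof -
  have "filterlim (\<lambda>x. x - R) at_top at_top"
    unfolding filterlim_at_top
  proof
    show "\<forall>\<^sub>F x in at_top. Z \<le> x - R" for Z
      using eventually_ge_at_top[of "Z + R"] by eventually_elim simp
  qed
  moreover have "filterlim (\<lambda>x. x - R) at_bot at_bot"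
    unfolding filterlim_at_bot
  proof
    show "\<forall>\<^sub>F x in at_bot. x - R \<le> Z" for Z
      using eventually_le_at_bot[of "Z + R"] by eventually_elim simp
  qed
  ultimately show "((\<lambda>x. tanh (x - R)) \<longlongrightarrow> (1::real)) at_top" "((\<lambda>x. tanh (x - R)) \<longlongrightarrow> (-1::real)) at_bot"
    using filterlim_compose[OF tanh_real_at_top] filterlim_compose[OF tanh_real_at_bot] by blast+
qed

lemma shifted_profile_transition: "transition_map (shifted_profile R)"
proof -
  have nz: "cosh x \<noteq> 0" for x :: real
    by simp
  have c: "continuous_on UNIV (\<lambda>x. tanh (x - R))" "continuous_on UNIV (\<lambda>x. 1 / cosh (x - R))"
    using nz by (auto intro!: continuous_intros)
  have H: "shifted_profile R \<in> H1_loc"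
    by (rule H1_locI[OF shifted_profile_ac])
      (auto simp: norm_vec3 intro!: locally_integrable_continuous continuous_intros c)
  have n: "norm (shifted_profile R x) = 1" for x
  proof -
    have "(norm (shifted_profile R x))\<^sup>2 = 1"
      unfolding norm_vec3 using inverse_cosh_square[of "x - R"] by (simp add: shifted_profile_def)
    then show ?thesis
      by (smt (verit) norm_ge_zero power2_eq_1_iff)
  qed
  have s: "((\<lambda>x. 1 / cosh (x - R)) \<longlongrightarrow> 0) F" if "((\<lambda>x. (tanh (x - R))\<^sup>2) \<longlongrightarrow> 1) F" for F
  proof -
    have "((\<lambda>x. sqrt (1 - (tanh (x - R))\<^sup>2)) \<longlongrightarrow> sqrt (1 - 1)) F"
      by (intro tendsto_intros that)
    moreover have "sqrt (1 - (tanh (x - R))\<^sup>2) = 1 / cosh (x - R)" for x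
      by (simp flip: inverse_cosh_square)
    ultimately show ?thesis by simp
  qed
  have l: "((\<lambda>x. 1 / cosh (x - R)) \<longlongrightarrow> 0) at_top" "((\<lambda>x. 1 / cosh (x - R)) \<longlongrightarrow> 0) at_bot"
    using tendsto_power[OF tanh_shift_limits(1)[of R], of 2] tendsto_power[OF tanh_shift_limits(2)[of R], of 2]
    by (auto intro!: s)
  have "(shifted_profile R \<longlongrightarrow> axis 1 1) at_top" "(shifted_profile R \<longlongrightarrow> - axis 1 1) at_bot"
    unfolding tendsto_vec3_iff using tanh_shift_limits[of R] l
    by (simp_all add: shifted_profile_def axis_def)
  then show ?thesis
    using H n by (simp add: transition_map_def)
qed

text \<open>Equipartition: apart from the weight, both energy terms of the profile equal
  \<open>1 - tanh^2\<close>, so for weight \<open>1\<close> the density is the derivative of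
  \<open>2 tanh (x - R)\<close>, with total \<open>4\<close>. The layer counts its share once
  more.\<close>

lemma energy_shifted_profile:
  "energy a (shifted_profile R) = ennreal (4 + 2 * (tanh (1 - R) - tanh (- 1 - R)))"
proof -
  let ?g = "\<lambda>x. vector [1 - (tanh (x - R))\<^sup>2, - tanh (x - R) * (1 / cosh (x - R)), 0] :: real^3"
  define e where "e x = 2 * (1 - (tanh (x - R))\<^sup>2)" for x
  have nz: "cosh x \<noteq> 0" for x :: real
    by simp
  have e0: "e x \<ge> 0" for x
    using inverse_cosh_square[of "x - R"] zero_le_power2[of "1 / cosh (x - R)"] by (simp add: e_def)
  have dF: "((\<lambda>x. 2 * tanh (x - R)) has_real_derivative e x) (at x)" for x
    unfolding e_def using nz by (auto intro!: derivative_eq_intros)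
  have ce: "continuous_on UNIV e"
    unfolding e_def using nz by (auto intro!: continuous_intros)
  then have ic: "isCont e x" for x
    by (simp add: continuous_on_eq_continuous_at)
  have lim: "((\<lambda>x. 2 * tanh (x - R)) \<longlongrightarrow> 2 * 1) at_top" "((\<lambda>x. 2 * tanh (x - R)) \<longlongrightarrow> 2 * (-1)) at_bot"
    by (intro tendsto_intros tanh_shift_limits)+
  have I: "set_integrable lborel (einterval (-\<infinity>) \<infinity>) e" "(LBINT x=-\<infinity>..\<infinity>. e x) = 2 - (-2)"
    by (rule interval_integral_FTC_nonneg[where F = "\<lambda>x. 2 * tanh (x - R)"];
        use dF ic e0 lim in \<open>simp add: ereal_tendsto_simps\<close>)+
  have ie: "integrable lborel e"
    using I(1) by (simp add: einterval_def set_integrable_def)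
  have Ie: "(LBINT x. e x) = 4"
    using I(2) by (simp add: interval_lebesgue_integral_def einterval_def set_lebesgue_integral_def)
  have "has_ac_deriv (\<lambda>x. 2 * tanh (x - R)) e"
    by (rule has_ac_deriv_piecewise[where S = "{}"])
      (use dF ce nz in \<open>auto simp: has_real_derivative_iff_has_vector_derivative intro!: continuous_intros locally_integrable_continuous\<close>)
  from has_ac_derivD(2)[OF this, of "-1" 1]
  have Ie1: "(LBINT x. indicator {-1..1} x * e x) = 2 * (tanh (1 - R) - tanh (-1 - R))"
    by (simp add: set_lebesgue_integral_def algebra_simps)
  have ie1: "integrable lborel (\<lambda>x. indicator {-1..1} x * e x)"
    using integrable_mult_indicator[OF _ ie, of "{-1..1}"] by simp
  have eq: "AE x in lborel. a x * (norm (weak_deriv (shifted_profile R) x))\<^sup>2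
      + a x * ((shifted_profile R x $ 2)\<^sup>2 + (shifted_profile R x $ 3)\<^sup>2) = e x + indicator {-1..1} x * e x"
    using weak_deriv_eq(2)[OF shifted_profile_ac[of R]] AE_weight
  proof eventually_elim
    case (elim x)
    have "(norm (?g x))\<^sup>2 = (1 - (tanh (x - R))\<^sup>2)\<^sup>2 + (tanh (x - R))\<^sup>2 * (1 / cosh (x - R))\<^sup>2"
      by (simp add: norm_vec3 power_mult_distrib power_divide)
    also have "\<dots> = 1 - (tanh (x - R))\<^sup>2"
      unfolding inverse_cosh_square by algebra
    finally have "(norm (?g x))\<^sup>2 = 1 - (tanh (x - R))\<^sup>2" .
    moreover have "(shifted_profile R x $ 2)\<^sup>2 + (shifted_profile R x $ 3)\<^sup>2 = 1 - (tanh (x - R))\<^sup>2"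
      using inverse_cosh_square[of "x - R"] by (simp add: shifted_profile_def)
    ultimately show ?case
      using elim by (auto simp: e_def indicator_def)
  qed
  have "energy a (shifted_profile R) = (\<integral>\<^sup>+x. ennreal (e x + indicator {-1..1} x * e x) \<partial>lborel)"
    unfolding energy_def by (rule nn_integral_cong_AE) (use eq in eventually_elim, simp)
  also have "\<dots> = ennreal (LBINT x. e x + indicator {-1..1} x * e x)"
    using ie ie1 e0 by (intro nn_integral_eq_integral) auto
  finally show ?thesis
    using ie ie1 by (simp add: Ie Ie1)
qed

lemma energy_infimum_le:
  assumes "is_arg_min (energy a) transition_map m"
  shows "energy a m \<le> 4"
proof -
  have "((\<lambda>R. tanh (c - R)) \<longlongrightarrow> (-1::real)) at_top" for c
  proof -
    have "((\<lambda>R. - tanh (R - c)) \<longlongrightarrow> - (1::real)) at_top"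
      by (intro tendsto_minus tanh_shift_limits)
    moreover have "- tanh (R - c) = tanh (c - R)" for R
      by (metis minus_diff_eq tanh_minus)
    ultimately show ?thesis by simp
  qed
  then have "((\<lambda>R. ennreal (4 + 2 * (tanh (1 - R) - tanh (- 1 - R)))) \<longlongrightarrow> ennreal (4 + 2 * (-1 - (-1)))) at_top"
    by (intro tendsto_ennrealI tendsto_intros)
  moreover have "energy a m \<le> ennreal (4 + 2 * (tanh (1 - R) - tanh (- 1 - R)))" for R
    using assms shifted_profile_transition[of R] unfolding is_arg_min_def energy_shifted_profile[symmetric]
    by (metis not_less)
  ultimately have "energy a m \<le> ennreal (4 + 2 * (-1 - (-1)))"
    by (intro tendsto_lowerbound[where F = at_top]) auto
  then show ?thesis by simp
qed

section \<open>Equality analysis in the lower energy bound\<close>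

lemma no_energy_le_4:
  assumes m: "transition_map m" and e4: "energy a m \<le> 4"
  shows False
proof -
  define g where "g = weak_deriv m"
  define u where "u x = m x $ 1" for x
  define s where "s x = (m x $ 2)\<^sup>2 + (m x $ 3)\<^sup>2" for x
  define G where "G x = (norm (g x))\<^sup>2" for x
  define h where "h x = a x * G x + a x * s x" for x
  define p where "p x = g x $ 1" for x
  have mg: "has_ac_deriv m g"
    using m H1_loc_has_ac_deriv by (auto simp: transition_map_def g_def)
  have n: "norm (m x) = 1" for x
    using m by (auto simp: transition_map_def)
  have us: "(u x)\<^sup>2 + s x = 1" for x
    using norm_vec3[of "m x"] n[of x] by (simp add: u_def s_def)
  have up: "has_ac_deriv u p"
    using mg has_ac_deriv_nth_iff by (auto simp: u_def[abs_def] p_def[abs_def])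
  have s0: "s x \<ge> 0" and G0: "G x \<ge> 0" for x
    by (simp_all add: s_def G_def)
  have [measurable]: "g \<in> borel_measurable borel" "m \<in> borel_measurable borel"
    using has_ac_derivD(1)[OF mg] has_ac_deriv_continuous[OF mg]
    by (auto intro: locally_integrable_measurable borel_measurable_continuous_onI)
  have [measurable]: "(\<lambda>x. m x $ i) \<in> borel_measurable borel" for i
    using has_ac_deriv_continuous[of "\<lambda>x. m x $ i"] mg has_ac_deriv_nth_iff
    by (blast intro: borel_measurable_continuous_onI)
  have [measurable]: "p \<in> borel_measurable borel" "u \<in> borel_measurable borel"
    using has_ac_derivD(1)[OF up] has_ac_deriv_continuous[OF up]
    by (auto intro: locally_integrable_measurable borel_measurable_continuous_onI)
  have [measurable]: "h \<in> borel_measurable borel"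
    unfolding h_def G_def s_def by measurable
  have ps: "AE x in lborel. (p x)\<^sup>2 \<le> G x * s x"
    using sphere_deriv_orthogonal[OF mg n]
  proof eventually_elim
    case (elim x)
    then show ?case
      using orthogonal_component_bound[OF _ elim] us[of x]
      by (simp add: p_def G_def s_def u_def norm_vec3)
  qed
  have a1: "AE x in lborel. a x \<ge> 1"
    using AE_weight by eventually_elim auto
  have ph: "AE x in lborel. 2 * \<bar>p x\<bar> \<le> h x"
    using ps a1
  proof eventually_elim
    case (elim x)
    have "(2 * \<bar>p x\<bar>)\<^sup>2 \<le> 4 * (G x * s x)"
      using elim by (simp add: power_mult_distrib)
    also have "\<dots> \<le> (G x + s x)\<^sup>2"
      using zero_le_power2[of "G x - s x"] by (simp add: power2_eq_square algebra_simps)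
    finally have "2 * \<bar>p x\<bar> \<le> G x + s x"
      by (rule power2_le_imp_le) (simp add: G0 s0)
    also have "\<dots> \<le> a x * (G x + s x)"
      using mult_right_mono[of 1 "a x" "G x + s x"] elim G0[of x] s0[of x] by simp
    finally show ?case by (simp add: h_def distrib_left)
  qed
  then have h0: "AE x in lborel. h x \<ge> 0"
    by eventually_elim simp
  have eh: "(\<integral>\<^sup>+x. ennreal (h x) \<partial>lborel) \<le> 4"
    using e4 by (simp add: energy_def h_def G_def s_def g_def)
  have ih: "integrable lborel h"
    by (rule integrableI_nonneg) (use h0 eh in \<open>auto intro: le_less_trans\<close>)
  then have h4: "(LBINT x. h x) \<le> 4"
    using eh h0 nn_integral_eq_integral[OF ih] by (metis ennreal_le_iff ennreal_numeral zero_le_numeral)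
  have ip: "integrable lborel (\<lambda>x. 2 * p x)"
    by (rule Bochner_Integration.integrable_bound[OF ih]) (use ph in \<open>auto elim!: eventually_mono simp: abs_mult\<close>)
  have lim: "(u \<longlongrightarrow> 1) at_top" "(u \<longlongrightarrow> -1) at_bot"
  proof -
    have "((\<lambda>x. m x $ 1) \<longlongrightarrow> axis 1 1 $ 1) at_top" "((\<lambda>x. m x $ 1) \<longlongrightarrow> (- axis 1 1) $ 1) at_bot"
      using m by (simp_all add: transition_map_def tendsto_vec3_iff)
    then show "(u \<longlongrightarrow> 1) at_top" "(u \<longlongrightarrow> -1) at_bot"
      by (simp_all add: u_def[abs_def])
  qed
  \<comment> \<open>Dominated convergence over growing symmetric intervals turns the limits of
    \<open>u\<close> at both ends into the value of the integral.\<close>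
  have "(LBINT x. 2 * p x) = 4"
  proof -
    have "(\<lambda>n. LBINT x. indicator {- real n..real n} x * (2 * p x)) \<longlonglongrightarrow> (LBINT x. 2 * p x)"
    proof (rule integral_dominated_convergence[where w = "\<lambda>x. \<bar>2 * p x\<bar>"])
      show "AE x in lborel. (\<lambda>n. indicator {- real n..real n} x * (2 * p x)) \<longlonglongrightarrow> 2 * p x"
      proof (intro AE_I2)
        fix x
        obtain N where N: "\<bar>x\<bar> \<le> real N" using real_arch_simple by blast
        have "\<forall>\<^sub>F n in sequentially. 2 * p x = indicator {- real n..real n} x * (2 * p x)"
          using eventually_ge_at_top[of N]
        proof eventually_elim
          case (elim n)
          then have "x \<in> {- real n..real n}" using N by auto
          then show ?case by simp
        qed
        then show "(\<lambda>n. indicator {- real n..real n} x * (2 * p x)) \<longlonglongrightarrow> 2 * p x"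
          by (rule Lim_transform_eventually[OF tendsto_const])
      qed
    qed (use ip in \<open>auto simp: indicator_def\<close>)
    moreover have "(LBINT x. indicator {- real n..real n} x * (2 * p x)) = 2 * (u (real n) - u (- real n))" for n
      using has_ac_derivD(2)[OF up, of "- real n" "real n"]
      by (simp add: set_lebesgue_integral_def mult.left_commute[of _ 2])
    moreover have "(\<lambda>n. 2 * (u (real n) - u (- real n))) \<longlonglongrightarrow> 2 * (1 - (-1))"
      by (intro tendsto_mult tendsto_diff tendsto_const filterlim_compose[OF lim(1) filterlim_real_sequentially]
          filterlim_compose[OF lim(2) filterlim_compose[OF filterlim_uminus_at_bot_at_top filterlim_real_sequentially]])
    ultimately show ?thesis
      using LIMSEQ_unique by fastforce
  qed
  then have "(LBINT x. h x - 2 * p x) \<le> 0"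
    using ih ip h4 by simp
  moreover have nn: "AE x in lborel. 0 \<le> h x - 2 * p x"
    using ph by eventually_elim auto
  ultimately have "(LBINT x. h x - 2 * p x) = 0"
    using integral_nonneg_AE[OF nn] by linarith
  then have "AE x in lborel. h x - 2 * p x = 0"
    using integral_nonneg_eq_0_iff_AE[OF Bochner_Integration.integrable_diff[OF ih ip] nn] by simp
  then have eq: "AE x in lborel. p x = 1 - (u x)\<^sup>2 \<and> (x \<in> {-1<..<1} \<longrightarrow> 1 - (u x)\<^sup>2 = 0)"
    using ps a1
  proof eventually_elim
    case (elim x)
    then have "p x = s x" "a x > 1 \<Longrightarrow> s x = 0"
      using equality_case[of "p x" "G x" "s x" "a x"] G0 s0 by (auto simp: h_def)
    then show ?case
      using us[of x] inside[of x] by auto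
  qed
  have cu: "continuous_on UNIV u"
    by (rule has_ac_deriv_continuous[OF up])
  \<comment> \<open>Both sides are continuous, so the almost-everywhere identity inside the layer
    holds at the point \<open>0\<close>.\<close>
  have "1 - (u 0)\<^sup>2 = 0"
    by (rule AE_eq_continuous[of "\<lambda>x. 1 - (u x)\<^sup>2" "\<lambda>_. 0" "{-1<..<1}"])
      (use eq in \<open>auto intro!: continuous_intros cu elim!: eventually_mono\<close>)
  then have "(u 0 - 1) * (u 0 + 1) = 0"
    by (simp add: power2_eq_square algebra_simps)
  then consider "u 0 = 1" | "u 0 = -1" by fastforce
  \<comment> \<open>The derivative \<open>p\<close> has the continuous representative
    \<open>1 - u^2\<close>, so \<open>u\<close> solves the equation classically, also across the
    interfaces.\<close>
  moreover have du: "(u has_real_derivative 1 - (u x)\<^sup>2) (at x)" for x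
  proof -
    have "has_ac_deriv u (\<lambda>x. 1 - (u x)\<^sup>2)"
      by (rule has_ac_deriv_cong_AE[OF up]) (use eq in \<open>auto elim!: eventually_mono\<close>)
    from has_ac_deriv_imp_derivative[OF this] show ?thesis
      unfolding has_real_derivative_iff_has_vector_derivative
      using cu by (auto simp: continuous_on_eq_continuous_at intro!: continuous_intros)
  qed
  moreover have u1: "\<bar>u x\<bar> \<le> 1" for x
    using us[of x] s0[of x] by (simp add: abs_square_le_1[symmetric])
  ultimately show False
  proof cases
    case 1
    have "u x \<ge> 1" if "x \<le> 0" for x
    proof -
      \<comment> \<open>The integrating factor replaces a uniqueness theorem for the equilibrium
        \<open>1\<close>: since \<open>1 - u^2 = (1 - u)(1 + u)\<close>, the derivative collapses to
        \<open>exp (2 t) (1 - u)^2\<close>. Monotonicity is used towards the left, where the limit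
        is \<open>-1\<close>.\<close>
      have "exp (2 * x) * (1 - u x) \<le> exp (2 * 0) * (1 - u 0)"
      proof (rule DERIV_nonneg_imp_nondecreasing[OF that], intro exI conjI)
        fix t
        show "((\<lambda>x. exp (2 * x) * (1 - u x)) has_real_derivative exp (2 * t) * (1 - u t)\<^sup>2) (at t)"
          by (auto intro!: derivative_eq_intros du simp: power2_eq_square algebra_simps)
        show "exp (2 * t) * (1 - u t)\<^sup>2 \<ge> 0" by simp
      qed
      then have "exp (2 * x) * (1 - u x) \<le> 0" using 1 by simp
      then show ?thesis by (simp add: mult_le_0_iff)
    qed
    then have "1 \<le> (-1::real)"
      by (intro tendsto_lowerbound[OF lim(2)]) (auto simp: eventually_at_bot_linorder)
    then show False by simp
  next
    case 2
    have "u x \<le> -1" if "x \<ge> 0" for x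
    proof -
      \<comment> \<open>The mirror case: the equilibrium \<open>-1\<close> propagates to the right,
        against the limit \<open>1\<close>.\<close>
      have "exp (- 2 * 0) * (1 + u 0) \<ge> exp (- 2 * x) * (1 + u x)"
      proof (rule DERIV_nonpos_imp_nonincreasing[OF that], intro exI conjI)
        fix t
        show "((\<lambda>x. exp (- 2 * x) * (1 + u x)) has_real_derivative - (exp (- 2 * t) * (1 + u t)\<^sup>2)) (at t)"
          by (auto intro!: derivative_eq_intros du simp: power2_eq_square algebra_simps)
        show "- (exp (- 2 * t) * (1 + u t)\<^sup>2) \<le> 0" by simp
      qed
      then have "exp (- 2 * x) * (1 + u x) \<le> 0" using 2 by simp
      then show ?thesis by (simp add: mult_le_0_iff)
    qed
    then have "1 \<le> (-1::real)"
      by (intro tendsto_upperbound[OF lim(1)]) (auto simp: eventually_at_top_linorder)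
    then show False by simp
  qed
qed

theorem no_minimizer: "\<not> is_arg_min (energy a) transition_map m"
  using energy_infimum_le no_energy_le_4 by (auto simp: is_arg_min_def)

end

section \<open>The profile on a half line\<close>

text \<open>Continuity bridges the interface \<open>c\<close>, where the derivative may not exist:
  the increment is an integral of \<open>f'\<close>, in which finitely many values do not
  count.\<close>

lemma mono_of_deriv_nonneg_off_point:
  fixes f :: "real \<Rightarrow> real"
  assumes "x \<le> y" "continuous_on {x..y} f"
    "\<And>t. x < t \<Longrightarrow> t < y \<Longrightarrow> t \<noteq> c \<Longrightarrow> (f has_real_derivative f' t) (at t)"
    "\<And>t. x < t \<Longrightarrow> t < y \<Longrightarrow> t \<noteq> c \<Longrightarrow> f' t \<ge> 0"
  shows "f x \<le> f y"
proof -
  have "(f' has_integral (f y - f x)) {x..y}"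
    by (rule fundamental_theorem_of_calculus_interior_strong[of "{c}"])
      (use assms in \<open>auto simp: has_real_derivative_iff_has_vector_derivative\<close>)
  then have "((\<lambda>t. if t \<in> {c, x, y} then 0 else f' t) has_integral (f y - f x)) {x..y}"
    by (rule has_integral_spike_finite[rotated 2, of _ _ _ "{c, x, y}"]) auto
  then have "0 \<le> f y - f x"
    by (rule has_integral_nonneg) (use assms(4) in auto)
  then show ?thesis by simp
qed

lemma const_of_deriv_zero:
  fixes f :: "real \<Rightarrow> real"
  assumes "x \<le> y" "continuous_on {x..y} f" "\<And>t. x < t \<Longrightarrow> t < y \<Longrightarrow> (f has_real_derivative 0) (at t)"
  shows "f x = f y"
  using DERIV_isconst_end[of x y f] assms by (cases "x = y") auto

text \<open>The phase plane form of the equation on a half line: \<open>w\<close> is the flux \<open>a \<partial>\<^sub>x \<phi>\<close>.\<close>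

locale half_profile =
  fixes b \<phi> w :: "real \<Rightarrow> real"
  assumes b_in: "\<And>x. 0 < x \<Longrightarrow> x < 1 \<Longrightarrow> b x = 2"
    and b_out: "\<And>x. x > 1 \<Longrightarrow> b x = 1"
    and b_meas: "b \<in> borel_measurable borel"
    and d_phi: "\<And>x. x > 0 \<Longrightarrow> x \<noteq> 1 \<Longrightarrow> (\<phi> has_real_derivative w x / b x) (at x)"
    and d_w: "\<And>x. x > 0 \<Longrightarrow> x \<noteq> 1 \<Longrightarrow> (w has_real_derivative - (b x * sin (\<phi> x) * cos (\<phi> x))) (at x)"
    and c_phi: "continuous_on UNIV \<phi>" and c_w: "continuous_on UNIV w"
    and phi_0: "\<phi> 0 = 0"
    and phi_range: "\<And>x. x > 0 \<Longrightarrow> 0 \<le> \<phi> x \<and> \<phi> x \<le> pi / 2"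
    and phi_lim: "(\<phi> \<longlongrightarrow> pi / 2) at_top"
    and w_int: "set_integrable lborel {0..} (\<lambda>x. (w x)\<^sup>2)"
begin

lemma continuous [continuous_intros]:
  "continuous_on A \<phi>" "continuous_on A w"
  using c_phi c_w continuous_on_subset by blast+

lemma measurable [measurable]:
  "\<phi> \<in> borel_measurable borel" "w \<in> borel_measurable borel" "b \<in> borel_measurable borel"
  using c_phi c_w b_meas by (auto intro: borel_measurable_continuous_onI)

lemma phase_range: "x \<ge> 0 \<Longrightarrow> 0 \<le> \<phi> x \<and> \<phi> x \<le> pi / 2"
  using phi_range[of x] phi_0 by (cases "x = 0") auto

lemma sin_cos_nonneg: "x \<ge> 0 \<Longrightarrow> sin (\<phi> x) \<ge> 0" "x \<ge> 0 \<Longrightarrow> cos (\<phi> x) \<ge> 0"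
  using phase_range[of x] by (auto intro!: sin_ge_zero cos_ge_zero)

lemma b_nonneg: "x > 0 \<Longrightarrow> x \<noteq> 1 \<Longrightarrow> b x \<ge> 0"
  using b_in[of x] b_out[of x] by (cases "x < 1") auto

text \<open>The phase stays in the first quadrant, so \<open>sin \<phi> cos \<phi>\<close> is
  nonnegative and the flux can only decrease.\<close>

lemma w_antimono:
  assumes "0 \<le> x" "x \<le> y"
  shows "w y \<le> w x"
proof -
  have "- w x \<le> - w y"
  proof (rule mono_of_deriv_nonneg_off_point[where c = 1 and f = "\<lambda>x. - w x"])
    fix t assume t: "x < t" "t < y" "t \<noteq> 1"
    then show "((\<lambda>x. - w x) has_real_derivative b t * sin (\<phi> t) * cos (\<phi> t)) (at t)"
      using DERIV_minus[OF d_w[of t]] assms by simp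
    show "0 \<le> b t * sin (\<phi> t) * cos (\<phi> t)"
      using t assms by (intro mult_nonneg_nonneg b_nonneg sin_cos_nonneg) auto
  qed (use assms in \<open>auto intro!: continuous_intros\<close>)
  then show ?thesis by simp
qed

lemma cos_lim: "((\<lambda>x. cos (\<phi> x)) \<longlongrightarrow> 0) at_top"
  using tendsto_cos[OF phi_lim] by simp

text \<open>The first integral \<open>w\<^sup>2 - cos\<^sup>2 \<phi>\<close> vanishes outside the layer because \<open>w\<close> is square integrable.\<close>

lemma w_square_outside: "x \<ge> 1 \<Longrightarrow> (w x)\<^sup>2 = (cos (\<phi> x))\<^sup>2"
proof -
  define C where "C = (w 1)\<^sup>2 - (cos (\<phi> 1))\<^sup>2"
  have eq: "(w x)\<^sup>2 = C + (cos (\<phi> x))\<^sup>2" if "x \<ge> 1" for x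
  proof -
    have "(w 1)\<^sup>2 - (cos (\<phi> 1))\<^sup>2 = (w x)\<^sup>2 - (cos (\<phi> x))\<^sup>2"
    proof (rule const_of_deriv_zero[OF that])
      show "continuous_on {1..x} (\<lambda>x. (w x)\<^sup>2 - (cos (\<phi> x))\<^sup>2)"
        by (intro continuous_intros)
      fix t :: real assume t: "1 < t"
      then have d: "(\<phi> has_real_derivative w t) (at t)" "(w has_real_derivative - (sin (\<phi> t) * cos (\<phi> t))) (at t)"
        using d_phi[of t] d_w[of t] b_out[of t] by auto
      show "((\<lambda>x. (w x)\<^sup>2 - (cos (\<phi> x))\<^sup>2) has_real_derivative 0) (at t)"
        by (rule derivative_eq_intros d refl)+ (simp add: algebra_simps)
    qed
    then show ?thesis by (simp add: C_def)
  qed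
  have "((\<lambda>x. C + (cos (\<phi> x))\<^sup>2) \<longlongrightarrow> C + 0\<^sup>2) at_top"
    by (intro tendsto_intros cos_lim)
  moreover have "\<forall>\<^sub>F x in at_top. 0 \<le> C + (cos (\<phi> x))\<^sup>2"
    using eventually_ge_at_top[of 1] by eventually_elim (simp flip: eq)
  ultimately have "C \<ge> 0"
    using tendsto_lowerbound by fastforce
  \<comment> \<open>A positive \<open>C\<close> bounds \<open>w\<^sup>2\<close> from below beyond
    the interface, so its integral over \<open>{1..1 + N}\<close> would grow at least like
    \<open>C * N\<close>.\<close>
  moreover have "\<not> C > 0"
  proof
    assume C: "C > 0"
    define M where "M = (LBINT x:{0..}. (w x)\<^sup>2)"
    have "C * N \<le> M" if "N > 0" for N
    proof -
      have "C * N = (LBINT x:{1..1 + N}. C)"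
        using that by (simp add: set_integral_const)
      also have "\<dots> \<le> M"
        unfolding M_def set_lebesgue_integral_def
      proof (rule integral_mono)
        show "integrable lborel (\<lambda>x. indicat_real {0..} x *\<^sub>R (w x)\<^sup>2)"
          using w_int by (simp add: set_integrable_def)
        show "integrable lborel (\<lambda>x. indicat_real {1..1 + N} x *\<^sub>R C)"
          using that by (intro integrable_scaleR_left integrable_real_indicator) auto
        show "indicat_real {1..1 + N} x *\<^sub>R C \<le> indicat_real {0..} x *\<^sub>R (w x)\<^sup>2" for x
          using eq[of x] by (auto simp: indicator_def)
      qed
      finally show ?thesis .
    qed
    \<comment> \<open>This choice of \<open>N\<close> makes \<open>C * N\<close> equal to
      \<open>\<bar>M\<bar> + 1\<close>, which exceeds \<open>M\<close>.\<close>
    from this[of "(\<bar>M\<bar> + 1) / C"] show False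
      using C by simp
  qed
  ultimately show "x \<ge> 1 \<Longrightarrow> (w x)\<^sup>2 = (cos (\<phi> x))\<^sup>2"
    using eq by simp
qed

lemma w_lim: "(w \<longlongrightarrow> 0) at_top"
proof (rule tendsto_rabs_zero_cancel, rule Lim_transform_eventually)
  show "((\<lambda>x. \<bar>cos (\<phi> x)\<bar>) \<longlongrightarrow> 0) at_top"
    using tendsto_rabs_zero[OF cos_lim] .
  show "\<forall>\<^sub>F x in at_top. \<bar>cos (\<phi> x)\<bar> = \<bar>w x\<bar>"
    using eventually_ge_at_top[of 1]
    by eventually_elim (use w_square_outside in \<open>metis power2_eq_iff abs_minus_cancel\<close>)
qed

lemma w_nonneg: "x \<ge> 0 \<Longrightarrow> w x \<ge> 0"
proof -
  assume x: "x \<ge> 0"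
  have "\<forall>\<^sub>F y in at_top. w y \<le> w x"
    using eventually_ge_at_top[of x] by eventually_elim (use w_antimono x in auto)
  then show ?thesis
    using tendsto_upperbound[OF w_lim] by force
qed

lemma w_outside: "x \<ge> 1 \<Longrightarrow> w x = cos (\<phi> x)"
  using w_square_outside[of x] w_nonneg[of x] sin_cos_nonneg(2)[of x] by (simp add: power2_eq_iff_nonneg)

text \<open>If the flux vanished at the interface, then \<open>\<phi> 1 = \<pi> / 2\<close> and \<open>\<partial>\<^sub>x \<phi> = cos \<phi> \<le> \<pi> / 2 - \<phi>\<close> inside
  the layer, so \<open>\<pi> / 2 - \<phi>\<close> decays at most exponentially and cannot reach \<open>0\<close> in finite time.\<close>

lemma w_1_pos: "w 1 > 0"
proof (rule ccontr)
  assume "\<not> w 1 > 0"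
  then have w1: "w 1 = 0" using w_nonneg[of 1] by simp
  then have c1: "cos (\<phi> 1) = 0" using w_outside[of 1] by simp
  \<comment> \<open>With weight \<open>2\<close> the first integral inside the layer is
    \<open>(w / 2)^2 - cos^2 \<phi>\<close>. It is \<open>0\<close> because both terms vanish at the
    interface, and nonnegativity of \<open>w\<close> and \<open>cos \<phi>\<close> selects the
    root.\<close>
  have half: "w x / 2 = cos (\<phi> x)" if x: "0 \<le> x" "x \<le> 1" for x
  proof -
    have "(w x / 2)\<^sup>2 - (cos (\<phi> x))\<^sup>2 = (w 1 / 2)\<^sup>2 - (cos (\<phi> 1))\<^sup>2"
    proof (rule const_of_deriv_zero[OF x(2)])
      show "continuous_on {x..1} (\<lambda>x. (w x / 2)\<^sup>2 - (cos (\<phi> x))\<^sup>2)"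
        by (intro continuous_intros) auto
      fix t :: real assume t: "x < t" "t < 1"
      then have d: "(\<phi> has_real_derivative w t / 2) (at t)" "(w has_real_derivative - (2 * sin (\<phi> t) * cos (\<phi> t))) (at t)"
        using d_phi[of t] d_w[of t] b_in[of t] x by auto
      show "((\<lambda>x. (w x / 2)\<^sup>2 - (cos (\<phi> x))\<^sup>2) has_real_derivative 0) (at t)"
        by (auto intro!: derivative_eq_intros d)
    qed
    then have "(w x / 2)\<^sup>2 = (cos (\<phi> x))\<^sup>2" using w1 c1 by simp
    then show ?thesis
      using w_nonneg[of x] sin_cos_nonneg(2)[of x] x by (subst (asm) power2_eq_iff_nonneg) auto
  qed
  have "exp 0 * (pi / 2 - \<phi> 0) \<le> exp 1 * (pi / 2 - \<phi> 1)"
  proof (rule mono_of_deriv_nonneg_off_point[where f = "\<lambda>x. exp x * (pi / 2 - \<phi> x)" and x = 0 and y = 1 and f' = "\<lambda>t. exp t * ((pi / 2 - \<phi> t) - w t / 2)" and c = 0])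
    show "continuous_on {0..1} (\<lambda>x. exp x * (pi / 2 - \<phi> x))"
      by (intro continuous_intros)
    fix t :: real assume t: "0 < t" "t < 1"
    then have d: "(\<phi> has_real_derivative w t / 2) (at t)"
      using d_phi[of t] b_in[of t] by auto
    show "((\<lambda>x. exp x * (pi / 2 - \<phi> x)) has_real_derivative exp t * (pi / 2 - \<phi> t - w t / 2)) (at t)"
      by (rule derivative_eq_intros d refl)+ (auto simp: algebra_simps)
    have "w t / 2 = sin (pi / 2 - \<phi> t)"
      using half[of t] t by (simp add: sin_cos_eq)
    also have "\<dots> \<le> pi / 2 - \<phi> t"
      using phase_range[of t] t by (intro sin_x_le_x) auto
    finally show "0 \<le> exp t * (pi / 2 - \<phi> t - w t / 2)" by simp
  qed simp
  moreover have "\<phi> 1 = pi / 2"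
  proof (rule ccontr)
    assume "\<phi> 1 \<noteq> pi / 2"
    then have "cos (\<phi> 1) > 0" using phase_range[of 1] by (intro cos_gt_zero_pi) auto
    then show False using c1 by simp
  qed
  ultimately show False using phi_0 pi_gt_zero by simp
qed

lemma w_0_pos: "w 0 > 0"
  using w_antimono[of 0 1] w_1_pos by simp

lemma w_bound: "x \<ge> 0 \<Longrightarrow> \<bar>w x\<bar> \<le> w 0"
  using w_antimono[of 0 x] w_nonneg[of x] by simp

text \<open>In the layer the slope is \<open>w / 2\<close>, at least \<open>w 1 / 2\<close> since
  the flux decreases; hence \<open>\<phi> 1 \<ge> w 1 / 2 > 0\<close>.\<close>

lemma sin_1_pos: "sin (\<phi> 1) > 0"
proof -
  have "\<phi> 0 - w 1 / 2 * 0 \<le> \<phi> 1 - w 1 / 2 * 1"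
  proof (rule mono_of_deriv_nonneg_off_point[where f = "\<lambda>x. \<phi> x - w 1 / 2 * x" and x = 0 and y = 1 and f' = "\<lambda>t. w t / 2 - w 1 / 2" and c = 0])
    fix t :: real assume t: "0 < t" "t < 1"
    then have d: "(\<phi> has_real_derivative w t / 2) (at t)"
      using d_phi[of t] b_in[of t] by auto
    show "((\<lambda>x. \<phi> x - w 1 / 2 * x) has_real_derivative w t / 2 - w 1 / 2) (at t)"
      by (rule derivative_eq_intros d refl)+ auto
    show "0 \<le> w t / 2 - w 1 / 2" using w_antimono[of t 1] t by simp
  qed (auto intro!: continuous_intros)
  then show ?thesis
    using phi_0 w_1_pos phase_range[of 1] by (intro sin_gt_zero) auto
qed

section \<open>The second variation in the direction of the flux, on a half line\<close>

definition quad :: "real \<Rightarrow> real" where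
  "quad x = b x * (b x * sin (\<phi> x) * cos (\<phi> x))\<^sup>2 - b x * cos (2 * \<phi> x) * (w x)\<^sup>2"

definition flux_product :: "real \<Rightarrow> real" where
  "flux_product x = w x * (sin (\<phi> x) * cos (\<phi> x))"

text \<open>In the product rule the force gives \<open>- b (sin \<phi> cos \<phi>)^2\<close> and the
  phase gives \<open>cos (2 \<phi>) w^2 / b\<close>. Multiplied by \<open>- b^2\<close>, these are
  the two terms of \<open>quad\<close>.\<close>

lemma d_flux_product:
  assumes "x > 0" "x \<noteq> 1"
  shows "(flux_product has_real_derivative - quad x / (b x)\<^sup>2) (at x)"
proof -
  have b: "b x \<noteq> 0" using b_in[of x] b_out[of x] assms by (cases "x < 1") auto
  have "(flux_product has_real_derivative
      - (b x * sin (\<phi> x) * cos (\<phi> x)) * (sin (\<phi> x) * cos (\<phi> x))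
      + ((cos (\<phi> x) * (w x / b x)) * cos (\<phi> x) + (- sin (\<phi> x) * (w x / b x)) * sin (\<phi> x)) * w x) (at x)"
    unfolding flux_product_def[abs_def]
    by (rule derivative_eq_intros d_phi d_w assms refl)+
  moreover have "- (b x * sin (\<phi> x) * cos (\<phi> x)) * (sin (\<phi> x) * cos (\<phi> x))
      + ((cos (\<phi> x) * (w x / b x)) * cos (\<phi> x) + (- sin (\<phi> x) * (w x / b x)) * sin (\<phi> x)) * w x = - quad x / (b x)\<^sup>2"
    unfolding quad_def cos_double using b by (simp add: field_simps power2_eq_square)
  ultimately show ?thesis by simp
qed

lemma continuous_flux_product: "continuous_on A flux_product"
  unfolding flux_product_def[abs_def] by (intro continuous_intros)

lemma quad_measurable [measurable]: "quad \<in> borel_measurable borel"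
  unfolding quad_def[abs_def] by measurable

text \<open>Beyond the interface the first integral gives
  \<open>cos\<^sup>2 \<phi> = w\<^sup>2\<close>, which is integrable; on \<open>{0..1}\<close> the
  bound \<open>1\<close> suffices.\<close>

lemma sin_cos_square_integrable:
  "set_integrable lborel {0..} (\<lambda>x. (sin (\<phi> x) * cos (\<phi> x))\<^sup>2)"
proof -
  have "integrable lborel (\<lambda>x. indicator {0..1} x + indicator {0..} x * (w x)\<^sup>2)"
    using w_int by (auto simp: set_integrable_def)
  then show ?thesis
    unfolding set_integrable_def
  proof (rule Bochner_Integration.integrable_bound)
    have "indicator {0..} x * (sin (\<phi> x) * cos (\<phi> x))\<^sup>2 \<le> indicator {0..1} x + indicator {0..} x * (w x)\<^sup>2" for x
    proof -
      have "(sin (\<phi> x))\<^sup>2 \<le> 1" "(cos (\<phi> x))\<^sup>2 \<le> 1"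
        by (simp_all add: abs_square_le_1)
      then have "(sin (\<phi> x) * cos (\<phi> x))\<^sup>2 \<le> 1" "(sin (\<phi> x) * cos (\<phi> x))\<^sup>2 \<le> (cos (\<phi> x))\<^sup>2"
        by (auto simp: power_mult_distrib intro!: mult_le_one mult_left_le_one_le)
      then show ?thesis
        using w_square_outside[of x] by (auto simp: indicator_def intro: add_increasing2)
    qed
    then show "AE x in lborel. norm (indicat_real {0..} x *\<^sub>R (sin (\<phi> x) * cos (\<phi> x))\<^sup>2)
        \<le> norm (indicat_real {0..1} x + indicat_real {0..} x * (w x)\<^sup>2)"
      by (auto intro!: AE_I2 order_trans[OF _ abs_ge_self])
  qed measurable
qed

lemma quad_integrable: "set_integrable lborel {0..} quad"
proof -
  \<comment> \<open>\<open>8 = 2^3\<close> bounds the factor \<open>b^3\<close> of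
    \<open>(sin \<phi> cos \<phi>)^2\<close>, and \<open>2\<close> bounds
    \<open>b cos (2 \<phi>)\<close>.\<close>
  have "integrable lborel (\<lambda>x. 8 * (indicator {0..} x * (sin (\<phi> x) * cos (\<phi> x))\<^sup>2) + 2 * (indicator {0..} x * (w x)\<^sup>2))"
    using w_int sin_cos_square_integrable by (auto simp: set_integrable_def)
  then show ?thesis
    unfolding set_integrable_def
  proof (rule Bochner_Integration.integrable_bound)
    show "AE x in lborel. norm (indicat_real {0..} x *\<^sub>R quad x)
       \<le> norm (8 * (indicator {0..} x * (sin (\<phi> x) * cos (\<phi> x))\<^sup>2) + 2 * (indicator {0..} x * (w x)\<^sup>2))"
      using AE_lborel_singleton[of 0] AE_lborel_singleton[of 1]
    proof eventually_elim
      case (elim x)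
      show ?case
      proof (cases "x > 0")
        case True
        have b: "\<bar>b x\<bar> \<le> 2" using True elim b_in[of x] b_out[of x] by (cases "x < 1") auto
        define s where "s = (sin (\<phi> x) * cos (\<phi> x))\<^sup>2"
        have s: "b x * (b x * sin (\<phi> x) * cos (\<phi> x))\<^sup>2 = b x ^ 3 * s"
          by (simp add: s_def power_mult_distrib power2_eq_square power3_eq_cube)
        have "\<bar>b x ^ 3 * s\<bar> \<le> 8 * s"
        proof -
          have "s \<ge> 0" by (simp add: s_def)
          then show ?thesis
            using mult_right_mono[OF power_mono[OF b, of 3], of s] by (simp add: abs_mult power_abs)
        qed
        moreover have "\<bar>b x * cos (2 * \<phi> x) * (w x)\<^sup>2\<bar> \<le> 2 * (w x)\<^sup>2"
        proof -
          have "\<bar>b x\<bar> * \<bar>cos (2 * \<phi> x)\<bar> \<le> 2 * 1"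
            using b by (intro mult_mono) auto
          then show ?thesis by (simp add: abs_mult mult_right_mono)
        qed
        moreover have "0 \<le> 8 * s + 2 * (w x)\<^sup>2" by (simp add: s_def)
        ultimately show ?thesis
          using True by (simp add: quad_def s s_def[symmetric])
      qed (use elim in auto)
    qed
  qed measurable
qed

text \<open>The integrand of the second variation in direction \<open>w\<close> is \<open>- a\<^sup>2\<close> times the derivative of
  \<open>w sin \<phi> cos \<phi>\<close>, so only the jump of \<open>a\<^sup>2\<close> from \<open>4\<close> to \<open>1\<close> contributes.\<close>

lemma quad_integral_neg: "(LBINT x:{0..}. quad x) < 0"
proof -
  have int: "set_integrable lborel {x..y} quad" if "x \<ge> 0" for x y
    by (rule set_integrable_subset[OF quad_integrable]) (use that in auto)
  \<comment> \<open>The squared weight is \<open>4\<close> on the first piece and \<open>1\<close>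
    on the second, so the interface collects \<open>- 4 + 1\<close>; at \<open>0\<close> the product
    vanishes with \<open>sin (\<phi> 0)\<close>.\<close>
  have I: "(LBINT x:{0..N}. quad x) = - 3 * flux_product 1 - flux_product N" if N: "N \<ge> 1" for N
  proof -
    have "(quad has_integral (- 4 * flux_product 1 - (- 4 * flux_product 0))) {0..1}"
    proof (rule fundamental_theorem_of_calculus_interior)
      fix x :: real assume x: "x \<in> {0<..<1}"
      have "((\<lambda>x. - 4 * flux_product x) has_real_derivative - 4 * (- quad x / (b x)\<^sup>2)) (at x)"
        by (intro DERIV_cmult d_flux_product) (use x in auto)
      then show "((\<lambda>x. - 4 * flux_product x) has_vector_derivative quad x) (at x)"
        using b_in[of x] x by (simp add: has_real_derivative_iff_has_vector_derivative)
    qed (auto intro!: continuous_intros continuous_flux_product)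
    moreover have "(quad has_integral (- flux_product N - (- flux_product 1))) {1..N}"
    proof (rule fundamental_theorem_of_calculus_interior)
      fix x :: real assume x: "x \<in> {1<..<N}"
      have "((\<lambda>x. - flux_product x) has_real_derivative - (- quad x / (b x)\<^sup>2)) (at x)"
        by (intro DERIV_minus d_flux_product) (use x in auto)
      then show "((\<lambda>x. - flux_product x) has_vector_derivative quad x) (at x)"
        using b_out[of x] x by (simp add: has_real_derivative_iff_has_vector_derivative)
    qed (use N in \<open>auto intro!: continuous_intros continuous_flux_product\<close>)
    ultimately have "(quad has_integral (- 4 * flux_product 1 - (- 4 * flux_product 0)) + (- flux_product N - (- flux_product 1))) {0..N}"
      by (rule has_integral_combine[rotated 2]) (use N in auto)
    moreover have "flux_product 0 = 0" by (simp add: flux_product_def phi_0)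
    ultimately show ?thesis
      using set_borel_integral_eq_integral(2)[OF int[of 0 N]] by (simp add: integral_unique)
  qed
  have "(flux_product \<longlongrightarrow> 0) at_top"
  proof (rule Lim_null_comparison[OF _ tendsto_rabs_zero[OF w_lim]])
    have "\<bar>sin t * cos t\<bar> \<le> 1" for t :: real
      by (simp add: abs_mult mult_le_one)
    then show "\<forall>\<^sub>F x in at_top. norm (flux_product x) \<le> \<bar>w x\<bar>"
      by (auto simp: flux_product_def abs_mult intro!: always_eventually mult_right_le_one_le)
  qed
  then have "((\<lambda>N. - 3 * flux_product 1 - flux_product N) \<longlongrightarrow> - 3 * flux_product 1 - 0) at_top"
    by (intro tendsto_intros)
  moreover have "\<forall>\<^sub>F N in at_top. (LBINT x:{0..N}. quad x) = - 3 * flux_product 1 - flux_product N"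
    using eventually_ge_at_top[of 1] by eventually_elim (rule I)
  ultimately have "((\<lambda>N. LBINT x:{0..N}. quad x) \<longlongrightarrow> - 3 * flux_product 1) at_top"
    by (simp add: tendsto_cong)
  moreover have "((\<lambda>N. LBINT x:{0..N}. quad x) \<longlongrightarrow> (LBINT x:{0..}. quad x)) at_top"
    by (rule tendsto_set_lebesgue_integral_at_top[OF _ quad_integrable]) simp
  ultimately have "(LBINT x:{0..}. quad x) = - 3 * flux_product 1"
    using tendsto_unique trivial_limit_at_top_linorder by blast
  moreover have "flux_product 1 > 0"
    using w_1_pos sin_1_pos w_outside[of 1] by (simp add: flux_product_def)
  ultimately show ?thesis by simp
qed

end

section \<open>The unstable direction\<close>

lemma locally_integrable_bounded:
  fixes f :: "real \<Rightarrow> real"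
  assumes [measurable]: "f \<in> borel_measurable borel" and B: "\<And>x. \<bar>f x\<bar> \<le> B"
  shows "locally_integrable UNIV f"
  unfolding locally_integrable_def set_integrable_def
proof (intro allI impI)
  fix K :: "real set" assume K: "compact K \<and> K \<subseteq> UNIV"
  then have [measurable]: "K \<in> sets borel" by (simp add: borel_compact)
  have "integrable lborel (\<lambda>x. indicator K x *\<^sub>R B)"
    using K emeasure_bounded_finite[OF compact_imp_bounded, of K]
    by (intro integrable_scaleR_left integrable_real_indicator) auto
  then show "integrable lborel (\<lambda>x. indicator K x *\<^sub>R f x)"
    by (rule Bochner_Integration.integrable_bound)
      (use B in \<open>auto intro!: AE_I2 mult_left_mono order_trans[OF B abs_ge_self] simp: abs_mult\<close>)
qed

lemma reflected_indicator: "indicator {0..} (- x) = (indicator {..0} x :: real)" for x :: real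
  by (auto simp: indicator_def)

lemma integrable_left:
  fixes f :: "real \<Rightarrow> real"
  assumes "set_integrable lborel {0..} f"
  shows "integrable lborel (\<lambda>x. indicator {..0} x * f (- x))"
  using assms lborel_integrable_real_affine[of "\<lambda>x. indicator {0..} x * f x" "-1" 0]
  by (simp add: set_integrable_def reflected_indicator)

lemma integral_left:
  fixes f :: "real \<Rightarrow> real"
  shows "(LBINT x. indicator {..0} x * f (- x)) = (LBINT x:{0..}. f x)"
  using lborel_integral_real_affine[of "-1" "\<lambda>x. indicator {0..} x * f x" 0]
  by (simp add: set_lebesgue_integral_def reflected_indicator)

section \<open>The flux of the given profile\<close>

locale critical_profile = layer +
  fixes \<phi> :: "real \<Rightarrow> real"
  assumes space: "\<phi> \<in> homogeneous_H1"
    and equation: "has_weak_deriv (UNIV - {0}) (\<lambda>x. a x * weak_deriv \<phi> x)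
                         (\<lambda>x. - (a x * sin (\<phi> x) * cos (\<phi> x)))"
    and at_0: "\<phi> 0 = 0"
    and at_top: "(\<phi> \<longlongrightarrow> pi / 2) at_top"
    and at_bot: "(\<phi> \<longlongrightarrow> - (pi / 2)) at_bot"
    and sign: "\<And>x. x > 0 \<Longrightarrow>
          - (pi / 2) \<le> \<phi> (- x) \<and> \<phi> (- x) \<le> 0 \<and> 0 \<le> \<phi> x \<and> \<phi> x \<le> pi / 2"
begin

lemma ac_weak_deriv: "has_ac_deriv \<phi> (weak_deriv \<phi>)"
  using space H1_loc_has_ac_deriv by (auto simp: homogeneous_H1_def)

lemma continuous_phase: "continuous_on A \<phi>"
  using ac_weak_deriv by (rule has_ac_deriv_continuous)

lemma measurable_phase [measurable]: "\<phi> \<in> borel_measurable borel" "weak_deriv \<phi> \<in> borel_measurable borel"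
  using continuous_phase has_ac_derivD(1)[OF ac_weak_deriv]
  by (auto intro: borel_measurable_continuous_onI locally_integrable_measurable)

text \<open>The values of the weight at \<open>\<plusminus>1\<close> are arbitrary.\<close>

definition bound :: real where
  "bound = 2 + \<bar>a 1\<bar> + \<bar>a (-1)\<bar>"

lemma weight_bound: "\<bar>a x\<bar> \<le> bound"
  using inside[of x] outside[of x]
  by (cases "x = 1"; cases "x = -1"; cases "x \<in> {-1<..<1}") (auto simp: bound_def)

definition force :: "real \<Rightarrow> real" where
  "force x = - (a x * sin (\<phi> x) * cos (\<phi> x))"

lemma measurable_force [measurable]: "force \<in> borel_measurable borel"
  unfolding force_def[abs_def] by measurable

lemma force_bound: "\<bar>force x\<bar> \<le> bound * \<bar>sin (\<phi> x) * cos (\<phi> x)\<bar>" "\<bar>force x\<bar> \<le> bound"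
proof -
  show *: "\<bar>force x\<bar> \<le> bound * \<bar>sin (\<phi> x) * cos (\<phi> x)\<bar>"
    using mult_right_mono[OF weight_bound[of x], of "\<bar>sin (\<phi> x) * cos (\<phi> x)\<bar>"]
    by (simp add: force_def abs_mult mult.assoc)
  have "\<bar>sin (\<phi> x) * cos (\<phi> x)\<bar> \<le> 1"
    by (simp add: abs_mult mult_le_one)
  from mult_left_mono[OF this, of bound] * show "\<bar>force x\<bar> \<le> bound"
    by (simp add: bound_def)
qed

lemma isCont_weight: "x \<notin> {-1, 1} \<Longrightarrow> isCont a x"
proof -
  assume x: "x \<notin> {-1, 1}"
  show ?thesis
  proof (cases "x \<in> {-1<..<1}")
    case True
    have "\<forall>\<^sub>F y in nhds x. a y = 2"
      using eventually_nhds_in_open[of "{-1<..<1}" x] True by (auto elim!: eventually_mono simp: inside)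
    then show ?thesis by (subst isCont_cong) auto
  next
    case False
    have "\<forall>\<^sub>F y in nhds x. y \<in> {..<-1} \<union> {1<..}"
      using False x by (intro eventually_nhds_in_open open_Un) auto
    then have "\<forall>\<^sub>F y in nhds x. a y = 1"
      by eventually_elim (auto intro!: outside)
    then show ?thesis by (subst isCont_cong) auto
  qed
qed

lemma isCont_phase: "isCont \<phi> x"
  using continuous_phase[of UNIV] by (simp add: continuous_on_eq_continuous_at)

lemma isCont_force: "x \<notin> {-1, 1} \<Longrightarrow> isCont force x"
  unfolding force_def[abs_def] by (intro continuous_intros isCont_weight isCont_phase)

lemma weight_nonzero: "x \<notin> {-1, 1} \<Longrightarrow> a x \<noteq> 0"
  using inside[of x] outside[of x] by (cases "x \<in> {-1<..<1}") auto

text \<open>On each half line the flux is a primitive of \<open>force\<close> up to a constant, and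
  the two constants may differ because the equation is not imposed at \<open>0\<close>. Both
  \<open>u\<close> and \<open>w\<close> are nevertheless primitives on the whole line, so each is
  continuous up to \<open>0\<close> and beyond.\<close>

lemma flux_exists:
  obtains u w where "has_ac_deriv u force" "has_ac_deriv w force"
    "AE x in lborel. x > 0 \<longrightarrow> a x * weak_deriv \<phi> x = w x"
    "AE x in lborel. x < 0 \<longrightarrow> a x * weak_deriv \<phi> x = u x"
proof -
  have "locally_integrable UNIV force"
    using force_bound(2) by (intro locally_integrable_bounded) auto
  then obtain W where W: "has_ac_deriv W force"
    using has_ac_deriv_exists by blast
  have eq: "has_weak_deriv (UNIV - {0}) (\<lambda>x. a x * weak_deriv \<phi> x) force"
    using equation by (simp add: force_def[abs_def])
  obtain c where c: "AE x in lborel. x \<in> {0<..} \<longrightarrow> a x * weak_deriv \<phi> x = c + W x"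
    by (rule weak_deriv_eq_primitive[OF _ _ _ _ eq W, of "{0<..}"]) (auto simp: is_interval_1)
  obtain d where d: "AE x in lborel. x \<in> {..<0} \<longrightarrow> a x * weak_deriv \<phi> x = d + W x"
    by (rule weak_deriv_eq_primitive[OF _ _ _ _ eq W, of "{..<0}"]) (auto simp: is_interval_1)
  have "has_ac_deriv (\<lambda>x. e + W x) force" for e
    using has_ac_deriv_add[OF has_ac_deriv_const W, of e] by simp
  with c d show thesis
    by (intro that[of "\<lambda>x. d + W x" "\<lambda>x. c + W x"]) (auto elim!: eventually_mono)
qed

end

text \<open>The witnesses of \<open>flux_exists\<close> become parameters, so that the definitions
  and the two half-line interpretations below can refer to them.\<close>

locale critical_flux = critical_profile +
  fixes u w :: "real \<Rightarrow> real"
  assumes u: "has_ac_deriv u force" and w: "has_ac_deriv w force"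
    and flux_right: "AE x in lborel. x > 0 \<longrightarrow> a x * weak_deriv \<phi> x = w x"
    and flux_left: "AE x in lborel. x < 0 \<longrightarrow> a x * weak_deriv \<phi> x = u x"
begin

lemma continuous_flux: "continuous_on A u" "continuous_on A w"
  using u w has_ac_deriv_continuous by blast+

lemma measurable_flux [measurable]: "u \<in> borel_measurable borel" "w \<in> borel_measurable borel"
  using continuous_flux by (auto intro: borel_measurable_continuous_onI)

text \<open>A representative of the derivative of \<open>\<phi>\<close> that is continuous off
  \<open>-1\<close>, \<open>0\<close>, \<open>1\<close>, in place of the arbitrary choice
  \<open>weak_deriv \<phi>\<close>.\<close>

definition slope :: "real \<Rightarrow> real" where
  "slope x = (if x > 0 then w x else u x) / a x"

lemma measurable_slope [measurable]: "slope \<in> borel_measurable borel"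
  unfolding slope_def[abs_def] by measurable

lemma AE_slope: "AE x in lborel. weak_deriv \<phi> x = slope x"
  using flux_right flux_left AE_lborel_singleton[of 0] AE_lborel_singleton[of 1] AE_lborel_singleton[of "-1"]
  by eventually_elim (use weight_nonzero in \<open>auto simp: slope_def field_simps\<close>)

lemma ac_slope: "has_ac_deriv \<phi> slope"
  by (rule has_ac_deriv_cong_AE[OF ac_weak_deriv AE_slope]) measurable

lemma isCont_slope: "x \<notin> {-1, 0, 1} \<Longrightarrow> isCont slope x"
proof -
  assume x: "x \<notin> {-1, 0, 1}"
  have c: "isCont u x" "isCont w x"
    using continuous_flux[of UNIV] by (auto simp: continuous_on_eq_continuous_at)
  show ?thesis
  proof (cases "x > 0")
    case True
    have "\<forall>\<^sub>F y in nhds x. slope y = w y / a y"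
      using eventually_nhds_in_open[of "{0<..}" x] True by (auto elim!: eventually_mono simp: slope_def)
    moreover have "isCont (\<lambda>y. w y / a y) x"
      using x by (intro continuous_divide c isCont_weight weight_nonzero) auto
    ultimately show ?thesis by (subst isCont_cong) auto
  next
    case False
    have "\<forall>\<^sub>F y in nhds x. slope y = u y / a y"
      using eventually_nhds_in_open[of "{..<0}" x] False x by (auto elim!: eventually_mono simp: slope_def)
    moreover have "isCont (\<lambda>y. u y / a y) x"
      using x by (intro continuous_divide c isCont_weight weight_nonzero) auto
    ultimately show ?thesis by (subst isCont_cong) auto
  qed
qed

lemma d_phase: "x \<notin> {-1, 0, 1} \<Longrightarrow> (\<phi> has_real_derivative slope x) (at x)"
  using has_ac_deriv_imp_derivative[OF ac_slope isCont_slope]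
  by (simp add: has_real_derivative_iff_has_vector_derivative)

lemma d_flux:
  "x \<notin> {-1, 1} \<Longrightarrow> (u has_real_derivative force x) (at x)"
  "x \<notin> {-1, 1} \<Longrightarrow> (w has_real_derivative force x) (at x)"
  using has_ac_deriv_imp_derivative[OF u isCont_force] has_ac_deriv_imp_derivative[OF w isCont_force]
  by (simp_all add: has_real_derivative_iff_has_vector_derivative)

lemma slope_square_integrable: "integrable lborel (\<lambda>x. (slope x)\<^sup>2)"
proof -
  have "integrable lborel (\<lambda>x. (norm (weak_deriv \<phi> x))\<^sup>2)"
    using space by (simp add: homogeneous_H1_def L2_def)
  then show ?thesis
    by (rule integrable_cong_AE_imp) (use AE_slope in \<open>auto elim!: eventually_mono\<close>)
qed

lemma flux_square_integrable:
  "integrable lborel (\<lambda>x. indicator {0..} x * (w x)\<^sup>2)" "integrable lborel (\<lambda>x. indicator {..0} x * (u x)\<^sup>2)"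
proof -
  have i: "integrable lborel (\<lambda>x. bound\<^sup>2 * (slope x)\<^sup>2)"
    using slope_square_integrable by simp
  have *: "(a x * slope x)\<^sup>2 \<le> bound\<^sup>2 * (slope x)\<^sup>2" for x
    using power_mono[OF weight_bound[of x], of 2] by (simp add: power_mult_distrib mult_right_mono)
  have n: "AE x in lborel. x \<notin> {-1, 0, 1::real}"
    using AE_lborel_singleton[of 0] AE_lborel_singleton[of 1] AE_lborel_singleton[of "-1"]
    by eventually_elim auto
  have "AE x in lborel. norm (indicator {0..} x * (w x)\<^sup>2) \<le> norm (bound\<^sup>2 * (slope x)\<^sup>2)"
    using n
  proof eventually_elim
    case (elim x)
    then show ?case
      using *[of x] weight_nonzero[of x] by (cases "x > 0") (auto simp: slope_def)
  qed
  then show "integrable lborel (\<lambda>x. indicator {0..} x * (w x)\<^sup>2)"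
    by (intro Bochner_Integration.integrable_bound[OF i]) measurable
  have "AE x in lborel. norm (indicator {..0} x * (u x)\<^sup>2) \<le> norm (bound\<^sup>2 * (slope x)\<^sup>2)"
    using n
  proof eventually_elim
    case (elim x)
    then show ?case
      using *[of x] weight_nonzero[of x] by (cases "x > 0") (auto simp: slope_def)
  qed
  then show "integrable lborel (\<lambda>x. indicator {..0} x * (u x)\<^sup>2)"
    by (intro Bochner_Integration.integrable_bound[OF i]) measurable
qed

sublocale R: half_profile a \<phi> w
proof
  show "(\<phi> has_real_derivative w x / a x) (at x)" if "x > 0" "x \<noteq> 1" for x
    using d_phase[of x] that by (simp add: slope_def)
  show "(w has_real_derivative - (a x * sin (\<phi> x) * cos (\<phi> x))) (at x)" if "x > 0" "x \<noteq> 1" for x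
    using d_flux(2)[of x] that by (simp add: force_def)
  show "set_integrable lborel {0..} (\<lambda>x. (w x)\<^sup>2)"
    using flux_square_integrable(1) by (simp add: set_integrable_def)
qed (use inside outside sign at_0 at_top continuous_phase continuous_flux in auto)

text \<open>Odd reflection carries the left half line to the right one. The sign in front of
  \<open>\<phi>\<close> and the sign from the chain rule cancel, so the reflected flux is
  \<open>u (- x)\<close> without a sign.\<close>

sublocale L: half_profile "\<lambda>x. a (- x)" "\<lambda>x. - \<phi> (- x)" "\<lambda>x. u (- x)"
proof
  show "((\<lambda>x. - \<phi> (- x)) has_real_derivative u (- x) / a (- x)) (at x)" if "x > 0" "x \<noteq> 1" for x
  proof -
    have "((\<lambda>x. \<phi> (- x)) has_real_derivative slope (- x) * - 1) (at x)"
      by (rule DERIV_chain'[where g = \<phi>]) (use d_phase[of "- x"] that in \<open>auto intro!: derivative_eq_intros\<close>)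
    from DERIV_minus[OF this] show ?thesis
      using that by (simp add: slope_def)
  qed
  show "((\<lambda>x. u (- x)) has_real_derivative - (a (- x) * sin (- \<phi> (- x)) * cos (- \<phi> (- x)))) (at x)"
    if "x > 0" "x \<noteq> 1" for x
  proof -
    have "((\<lambda>x. u (- x)) has_real_derivative force (- x) * - 1) (at x)"
      by (rule DERIV_chain'[where g = u]) (use d_flux(1)[of "- x"] that in \<open>auto intro!: derivative_eq_intros\<close>)
    then show ?thesis by (simp add: force_def)
  qed
  show "continuous_on UNIV (\<lambda>x. - \<phi> (- x))" "continuous_on UNIV (\<lambda>x. u (- x))"
    by (intro continuous_intros continuous_on_compose2[OF continuous_phase[of UNIV]]
        continuous_on_compose2[OF continuous_flux(1)[of UNIV]]; simp)+
  show "((\<lambda>x. - \<phi> (- x)) \<longlongrightarrow> pi / 2) at_top"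
    using tendsto_minus[OF filterlim_compose[OF at_bot filterlim_uminus_at_bot_at_top]] by simp
  show "set_integrable lborel {0..} (\<lambda>x. (u (- x))\<^sup>2)"
  proof -
    have "integrable lborel (\<lambda>x. indicator {..0} (- x) * (u (- x))\<^sup>2)"
      using lborel_integrable_real_affine[OF flux_square_integrable(2), of "-1" 0] by simp
    moreover have "indicator {..0} (- x) = (indicator {0..} x :: real)" for x :: real
      by (auto simp: indicator_def)
    ultimately show ?thesis by (simp add: set_integrable_def)
  qed
  show "(\<lambda>x. a (- x)) \<in> borel_measurable borel" by measurable
  show "0 \<le> - \<phi> (- x) \<and> - \<phi> (- x) \<le> pi / 2" if "x > 0" for x
    using sign[OF that] by linarith
qed (use inside outside sign at_0 in auto)

section \<open>Gluing the two half-line directions\<close>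

definition ratio :: real where
  "ratio = w 0 / u 0"

lemma u_0_pos: "u 0 > 0"
  using L.w_0_pos by simp

lemma ratio_pos: "ratio > 0"
  using u_0_pos R.w_0_pos by (simp add: ratio_def)

text \<open>Since the derivative of the flux vanishes at \<open>0\<close>, the two one-sided fluxes may be rescaled
  independently to match at \<open>0\<close>; no symmetry of \<open>\<phi>\<close> is required.\<close>

definition \<eta> :: "real \<Rightarrow> real" where
  "\<eta> x = (if x \<ge> 0 then w x else ratio * u x)"

definition \<eta>' :: "real \<Rightarrow> real" where
  "\<eta>' x = (if x \<ge> 0 then force x else ratio * force x)"

lemma continuous_direction: "continuous_on UNIV \<eta>"
proof -
  \<comment> \<open>Clamping writes \<open>\<eta>\<close> as a sum of continuous functions: the
    inactive branch contributes \<open>w 0\<close>, because \<open>ratio * u 0 = w 0\<close>, and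
    this is subtracted.\<close>
  have "\<eta> = (\<lambda>x. w (max x 0) + ratio * u (min x 0) - w 0)"
    using u_0_pos by (auto simp: \<eta>_def ratio_def fun_eq_iff max_def min_def)
  moreover have "continuous_on UNIV (\<lambda>x. w (max x 0) + ratio * u (min x 0) - w 0)"
    by (intro continuous_intros continuous_on_compose2[OF continuous_flux(1)[of UNIV]]
        continuous_on_compose2[OF continuous_flux(2)[of UNIV]]) auto
  ultimately show ?thesis by simp
qed

lemma measurable_direction [measurable]: "\<eta> \<in> borel_measurable borel" "\<eta>' \<in> borel_measurable borel"
  unfolding \<eta>_def[abs_def] \<eta>'_def[abs_def] by measurable

lemma direction_ac: "has_ac_deriv \<eta> \<eta>'"
proof (rule has_ac_deriv_piecewise[where S = "{-1, 0, 1}"])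
  show "locally_integrable UNIV \<eta>'"
  proof (rule locally_integrable_bounded)
    fix x
    have "\<bar>\<eta>' x\<bar> \<le> (if x \<ge> 0 then 1 else ratio) * bound"
      using force_bound(2)[of x] ratio_pos by (auto simp: \<eta>'_def abs_mult)
    also have "\<dots> \<le> (1 + ratio) * bound"
      using ratio_pos by (intro mult_right_mono) (auto simp: bound_def)
    finally show "\<bar>\<eta>' x\<bar> \<le> (1 + ratio) * bound" .
  qed measurable
  fix x :: real assume x: "x \<notin> {-1, 0, 1}"
  show "(\<eta> has_vector_derivative \<eta>' x) (at x)"
  proof (cases "x > 0")
    case True
    have "(w has_vector_derivative \<eta>' x) (at x)"
      using d_flux(2)[of x] x True by (simp add: \<eta>'_def has_real_derivative_iff_has_vector_derivative)
    then show ?thesis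
      by (rule has_vector_derivative_transform_within_open[of _ _ _ "{0<..}"]) (use True in \<open>auto simp: \<eta>_def\<close>)
  next
    case False
    have "((\<lambda>x. ratio * u x) has_real_derivative \<eta>' x) (at x)"
      using DERIV_cmult[OF d_flux(1)[of x], of ratio] x False by (simp add: \<eta>'_def)
    then have "((\<lambda>x. ratio * u x) has_vector_derivative \<eta>' x) (at x)"
      by (simp add: has_real_derivative_iff_has_vector_derivative)
    then show ?thesis
      by (rule has_vector_derivative_transform_within_open[of _ _ _ "{..<0}"]) (use False x in \<open>auto simp: \<eta>_def\<close>)
  qed
qed (use continuous_direction in auto)

lemma direction_square_integrable: "integrable lborel (\<lambda>x. (\<eta> x)\<^sup>2)"
proof -
  have "integrable lborel (\<lambda>x. indicator {0..} x * (w x)\<^sup>2 + ratio\<^sup>2 * (indicator {..0} x * (u x)\<^sup>2))"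
    using flux_square_integrable by (intro Bochner_Integration.integrable_add integrable_mult_right) auto
  then show ?thesis
  proof (rule integrable_cong_AE_imp)
    show "AE x in lborel. indicator {0..} x * (w x)\<^sup>2 + ratio\<^sup>2 * (indicator {..0} x * (u x)\<^sup>2) = (\<eta> x)\<^sup>2"
      using AE_lborel_singleton[of 0]
      by eventually_elim (auto simp: \<eta>_def indicator_def power_mult_distrib)
  qed measurable
qed

lemma direction_deriv_square_integrable: "integrable lborel (\<lambda>x. (\<eta>' x)\<^sup>2)"
proof -
  let ?s = "\<lambda>x. (sin (\<phi> x) * cos (\<phi> x))\<^sup>2"
  have "integrable lborel (\<lambda>x. indicator {0..} x * ?s x)"
    using R.sin_cos_square_integrable by (simp add: set_integrable_def)
  moreover have "integrable lborel (\<lambda>x. indicator {..0} x * ?s x)"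
    using integrable_left[OF L.sin_cos_square_integrable] by simp
  ultimately have i: "integrable lborel (\<lambda>x. bound\<^sup>2 * (indicator {0..} x * ?s x) + (ratio * bound)\<^sup>2 * (indicator {..0} x * ?s x))"
    by (intro Bochner_Integration.integrable_add integrable_mult_right)
  have f: "(force x)\<^sup>2 \<le> bound\<^sup>2 * ?s x" for x
    using power_mono[OF force_bound(1)[of x], of 2] by (simp add: power_mult_distrib)
  have "(\<eta>' x)\<^sup>2 \<le> bound\<^sup>2 * (indicator {0..} x * ?s x) + (ratio * bound)\<^sup>2 * (indicator {..0} x * ?s x)" for x
  proof (cases "x \<ge> 0")
    case True
    then show ?thesis using f[of x] by (simp add: \<eta>'_def add_increasing2)
  next
    case False
    then show ?thesis
      using mult_left_mono[OF f[of x], of "ratio\<^sup>2"] by (simp add: \<eta>'_def power_mult_distrib mult.assoc)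
  qed
  then show ?thesis
    by (intro Bochner_Integration.integrable_bound[OF i]) (auto intro!: AE_I2 order_trans[OF _ abs_ge_self])
qed

lemma direction_H1: "\<eta> \<in> H1"
  using direction_ac direction_deriv_square_integrable direction_square_integrable
  by (intro H1I[where g = \<eta>']) auto

text \<open>Each flux is largest at \<open>0\<close> on its own side, and the rescaling makes the
  two maxima agree. The bound puts \<open>\<eta>\<close> times the slope into \<open>L2\<close>, as
  needed for \<open>v\<close>.\<close>

lemma direction_bound: "\<bar>\<eta> x\<bar> \<le> w 0"
proof (cases "x \<ge> 0")
  case False
  have "ratio * \<bar>u x\<bar> \<le> ratio * u 0"
    using L.w_bound[of "- x"] False ratio_pos by simp
  then show ?thesis
    using False ratio_pos u_0_pos R.w_0_pos by (simp add: \<eta>_def abs_mult ratio_def)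
qed (simp add: \<eta>_def R.w_bound)

definition second_variation_density :: "real \<Rightarrow> real" where
  "second_variation_density x = a x * (\<eta>' x)\<^sup>2 - a x * cos (2 * \<phi> x) * (\<eta> x)\<^sup>2"

text \<open>The form splits over the half lines. On the left the reflected profile applies and the
  rescaling enters as \<open>ratio\<^sup>2\<close>, so both contributions are negative.\<close>

lemma second_variation_density_integral_neg: "(LBINT x. second_variation_density x) < 0"
proof -
  have eq: "AE x in lborel. second_variation_density x = indicator {0..} x * R.quad x + ratio\<^sup>2 * (indicator {..0} x * L.quad (- x))"
    using AE_lborel_singleton[of 0]
    by eventually_elim
      (auto simp: second_variation_density_def \<eta>_def \<eta>'_def force_def R.quad_def L.quad_def indicator_def power_mult_distrib algebra_simps)
  have [measurable]: "second_variation_density \<in> borel_measurable borel"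
    unfolding second_variation_density_def[abs_def] by measurable
  have i: "integrable lborel (\<lambda>x. indicator {0..} x * R.quad x)" "integrable lborel (\<lambda>x. indicator {..0} x * L.quad (- x))"
    using R.quad_integrable integrable_left[OF L.quad_integrable] by (simp_all add: set_integrable_def)
  have "(LBINT x. second_variation_density x) = (LBINT x. indicator {0..} x * R.quad x + ratio\<^sup>2 * (indicator {..0} x * L.quad (- x)))"
    by (rule integral_cong_AE[OF _ _ eq]) measurable
  also have "\<dots> = (LBINT x:{0..}. R.quad x) + ratio\<^sup>2 * (LBINT x:{0..}. L.quad x)"
    using i integral_left[of L.quad] by (simp add: set_lebesgue_integral_def[of _ _ R.quad])
  also have "\<dots> < 0"
    using R.quad_integral_neg L.quad_integral_neg ratio_pos by (simp add: add_neg_neg mult_pos_neg)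
  finally show ?thesis .
qed

lemma angle_unstable: "second_variation_angle a \<phi> \<eta> < 0"
proof -
  have [measurable]: "weak_deriv \<eta> \<in> borel_measurable borel"
    using has_ac_derivD(1)[OF weak_deriv_eq(1)[OF direction_ac]] by (rule locally_integrable_measurable)
  have "second_variation_angle a \<phi> \<eta> = (LBINT x. second_variation_density x)"
    unfolding second_variation_angle_def second_variation_density_def
    by (rule integral_cong_AE) (use weak_deriv_eq(2)[OF direction_ac] in \<open>auto elim!: eventually_mono\<close>)
  then show ?thesis using second_variation_density_integral_neg by simp
qed

section \<open>The tangent direction of the map\<close>

definition v :: "real \<Rightarrow> real^3" where
  "v x = vector [\<eta> x * cos (\<phi> x), \<eta> x * (- sin (\<phi> x)), 0]"

definition v' :: "real \<Rightarrow> real^3" where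
  "v' x = vector [\<eta>' x * cos (\<phi> x) + \<eta> x * (- sin (\<phi> x) * slope x),
     \<eta>' x * (- sin (\<phi> x)) + \<eta> x * (- cos (\<phi> x) * slope x), 0]"

lemma ac_sin_cos:
  "has_ac_deriv (\<lambda>x. cos (\<phi> x)) (\<lambda>x. - sin (\<phi> x) * slope x)"
  "has_ac_deriv (\<lambda>x. - sin (\<phi> x)) (\<lambda>x. - cos (\<phi> x) * slope x)"
  "has_ac_deriv (\<lambda>x. sin (\<phi> x)) (\<lambda>x. cos (\<phi> x) * slope x)"
proof -
  have l: "locally_integrable UNIV (\<lambda>x. h x * slope x)" if "continuous_on UNIV h" for h
    using that has_ac_derivD(1)[OF ac_slope] by (intro locally_integrable_mult_continuous)
  show "has_ac_deriv (\<lambda>x. cos (\<phi> x)) (\<lambda>x. - sin (\<phi> x) * slope x)"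
  proof (rule has_ac_deriv_piecewise[where S = "{-1, 0, 1}"])
    fix x :: real assume "x \<notin> {-1, 0, 1}"
    note d = d_phase[OF this]
    have "((\<lambda>x. cos (\<phi> x)) has_real_derivative - sin (\<phi> x) * slope x) (at x)"
      by (auto intro!: derivative_eq_intros d)
    then show "((\<lambda>x. cos (\<phi> x)) has_vector_derivative - sin (\<phi> x) * slope x) (at x)"
      by (simp add: has_real_derivative_iff_has_vector_derivative)
  next
    show "continuous_on UNIV (\<lambda>x. cos (\<phi> x))"
      by (intro continuous_intros continuous_phase)
    show "locally_integrable UNIV (\<lambda>x. - sin (\<phi> x) * slope x)"
      by (intro l continuous_intros continuous_phase)
  qed simp
  show "has_ac_deriv (\<lambda>x. - sin (\<phi> x)) (\<lambda>x. - cos (\<phi> x) * slope x)"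
  proof (rule has_ac_deriv_piecewise[where S = "{-1, 0, 1}"])
    fix x :: real assume "x \<notin> {-1, 0, 1}"
    note d = d_phase[OF this]
    have "((\<lambda>x. - sin (\<phi> x)) has_real_derivative - cos (\<phi> x) * slope x) (at x)"
      by (auto intro!: derivative_eq_intros d)
    then show "((\<lambda>x. - sin (\<phi> x)) has_vector_derivative - cos (\<phi> x) * slope x) (at x)"
      by (simp add: has_real_derivative_iff_has_vector_derivative)
  next
    show "continuous_on UNIV (\<lambda>x. - sin (\<phi> x))"
      by (intro continuous_intros continuous_phase)
    show "locally_integrable UNIV (\<lambda>x. - cos (\<phi> x) * slope x)"
      by (intro l continuous_intros continuous_phase)
  qed simp
  show "has_ac_deriv (\<lambda>x. sin (\<phi> x)) (\<lambda>x. cos (\<phi> x) * slope x)"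
  proof (rule has_ac_deriv_piecewise[where S = "{-1, 0, 1}"])
    fix x :: real assume "x \<notin> {-1, 0, 1}"
    note d = d_phase[OF this]
    have "((\<lambda>x. sin (\<phi> x)) has_real_derivative cos (\<phi> x) * slope x) (at x)"
      by (auto intro!: derivative_eq_intros d)
    then show "((\<lambda>x. sin (\<phi> x)) has_vector_derivative cos (\<phi> x) * slope x) (at x)"
      by (simp add: has_real_derivative_iff_has_vector_derivative)
  next
    show "continuous_on UNIV (\<lambda>x. sin (\<phi> x))"
      by (intro continuous_intros continuous_phase)
    show "locally_integrable UNIV (\<lambda>x. cos (\<phi> x) * slope x)"
      by (intro l continuous_intros continuous_phase)
  qed simp
qed

lemma v_ac: "has_ac_deriv v v'"
  unfolding v_def[abs_def] v'_def[abs_def]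
  by (intro has_ac_deriv_vec3 has_ac_deriv_mult direction_ac ac_sin_cos has_ac_deriv_const)

text \<open>The vectors \<open>(cos t, - sin t)\<close> and \<open>(- sin t, - cos t)\<close> are
  orthonormal, and \<open>p\<close> and \<open>q r\<close> are the coordinates in this
  frame.\<close>

lemma rotation_norm:
  "(p * cos t + q * (- sin t * r))\<^sup>2 + (p * (- sin t) + q * (- cos t * r))\<^sup>2 = p\<^sup>2 + q\<^sup>2 * (r::real)\<^sup>2"
proof -
  have "(p * cos t + q * (- sin t * r))\<^sup>2 + (p * (- sin t) + q * (- cos t * r))\<^sup>2
      = (p\<^sup>2 + q\<^sup>2 * r\<^sup>2) * ((sin t)\<^sup>2 + (cos t)\<^sup>2)"
    by algebra
  then show ?thesis by simp
qed

lemma norm_v: "(norm (v x))\<^sup>2 = (\<eta> x)\<^sup>2"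
  unfolding norm_vec3 v_def vector_3 using rotation_norm[of "\<eta> x" "\<phi> x" 0 0] by simp

lemma norm_v': "(norm (v' x))\<^sup>2 = (\<eta>' x)\<^sup>2 + (\<eta> x)\<^sup>2 * (slope x)\<^sup>2"
  unfolding norm_vec3 v'_def vector_3 rotation_norm by simp

lemma v_H1: "v \<in> H1"
proof (rule H1I[OF v_ac])
  show "integrable lborel (\<lambda>x. (norm (v x))\<^sup>2)"
    unfolding norm_v by (rule direction_square_integrable)
  have "integrable lborel (\<lambda>x. (\<eta> x)\<^sup>2 * (slope x)\<^sup>2)"
  proof (rule Bochner_Integration.integrable_bound)
    show "integrable lborel (\<lambda>x. (w 0)\<^sup>2 * (slope x)\<^sup>2)"
      using slope_square_integrable by simp
    show "AE x in lborel. norm ((\<eta> x)\<^sup>2 * (slope x)\<^sup>2) \<le> norm ((w 0)\<^sup>2 * (slope x)\<^sup>2)"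
      using power_mono[OF direction_bound, of _ 2] by (auto intro!: AE_I2 mult_right_mono)
  qed measurable
  then show "integrable lborel (\<lambda>x. (norm (v' x))\<^sup>2)"
    unfolding norm_v' using direction_deriv_square_integrable by simp
qed

text \<open>The turning of the tangent frame contributes
  \<open>a \<eta>\<^sup>2 (\<partial>\<^sub>x \<phi>)\<^sup>2\<close>, which the gradient part of
  the multiplier cancels. The remaining coefficient
  \<open>sin\<^sup>2 \<phi> - cos\<^sup>2 \<phi> = - cos (2 \<phi>)\<close> is that of
  \<open>Q\<close>.\<close>

lemma map_unstable:
  fixes m :: "real \<Rightarrow> real^3"
  assumes m: "m = (\<lambda>x. vector [sin (\<phi> x), cos (\<phi> x), 0])"
  shows "second_variation_map a m v < 0"
proof -
  have m_ac: "has_ac_deriv m (\<lambda>x. vector [cos (\<phi> x) * slope x, - sin (\<phi> x) * slope x, 0])"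
    unfolding m by (intro has_ac_deriv_vec3 ac_sin_cos has_ac_deriv_const)
  have [measurable]: "weak_deriv v \<in> borel_measurable borel" "weak_deriv m \<in> borel_measurable borel"
    using has_ac_derivD(1)[OF weak_deriv_eq(1)[OF v_ac]] has_ac_derivD(1)[OF weak_deriv_eq(1)[OF m_ac]]
    by (auto intro: locally_integrable_measurable)
  have m2: "m x $ 2 = cos (\<phi> x)" and v23: "v x $ 2 = \<eta> x * (- sin (\<phi> x))" "v x $ 3 = 0" for x
    by (simp_all add: m v_def)
  have nm: "(norm (vector [cos t * r, - sin t * r, 0] :: real^3))\<^sup>2 = r\<^sup>2" for t r :: real
    unfolding norm_vec3 vector_3 using rotation_norm[of 0 "- t" 1 r] by (simp add: add.commute)
  have "second_variation_map a m v = (LBINT x. second_variation_density x)"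
    unfolding second_variation_map_def lagrange_multiplier_def second_variation_density_def m2 v23 norm_v
  proof (rule integral_cong_AE)
    show "AE x in lborel. a x * (norm (weak_deriv v x))\<^sup>2 + a x * ((\<eta> x * - sin (\<phi> x))\<^sup>2 + 0\<^sup>2) -
        (a x * (norm (weak_deriv m x))\<^sup>2 + a x * (cos (\<phi> x))\<^sup>2) * (\<eta> x)\<^sup>2
        = a x * (\<eta>' x)\<^sup>2 - a x * cos (2 * \<phi> x) * (\<eta> x)\<^sup>2"
      using weak_deriv_eq(2)[OF v_ac] weak_deriv_eq(2)[OF m_ac]
    proof eventually_elim
      case (elim x)
      show ?case
        unfolding elim nm norm_v' cos_double by (simp add: power_mult_distrib algebra_simps)
    qed
  qed measurable
  then show ?thesis using second_variation_density_integral_neg by simp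
qed

lemma v_tangent: "v x \<bullet> vector [sin (\<phi> x), cos (\<phi> x), 0] = 0"
  by (simp add: v_def inner_vec_def sum_3)

end

theorem proposition4:
  fixes a \<phi> :: "real \<Rightarrow> real" and m :: "real \<Rightarrow> real^3"
  assumes a_even: "\<And>x. a (- x) = a x"
    and a_inside: "\<And>x. x \<in> {-1<..<1} \<Longrightarrow> a x = 2"
    and a_outside: "\<And>x. x \<notin> {-1..1} \<Longrightarrow> a x = 1"
    and phi_space: "\<phi> \<in> homogeneous_H1"
    and phi_equation: "has_weak_deriv (UNIV - {0}) (\<lambda>x. a x * weak_deriv \<phi> x)
                         (\<lambda>x. - (a x * sin (\<phi> x) * cos (\<phi> x)))"
    and phi_0: "\<phi> 0 = 0"
    and phi_at_top: "(\<phi> \<longlongrightarrow> pi / 2) at_top"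
    and phi_at_bot: "(\<phi> \<longlongrightarrow> - (pi / 2)) at_bot"
    and phi_sign: "\<And>x. x > 0 \<Longrightarrow>
          - (pi / 2) \<le> \<phi> (- x) \<and> \<phi> (- x) \<le> 0 \<and> 0 \<le> \<phi> x \<and> \<phi> x \<le> pi / 2"
    and m_eq: "m = (\<lambda>x. vector [sin (\<phi> x), cos (\<phi> x), 0])"
  shows "(\<exists>\<eta>\<in>H1. second_variation_angle a \<phi> \<eta> < 0) \<and>
         (\<exists>v\<in>H1. (\<forall>x. v x \<bullet> m x = 0) \<and> second_variation_map a m v < 0) \<and>
         \<not> (\<exists>m'. is_arg_min (energy a) transition_map m')"
proof -
  interpret layer a
    by standard (fact a_inside, fact a_outside)
  interpret critical_profile a \<phi>
    by standard (fact phi_space phi_equation phi_0 phi_at_top phi_at_bot phi_sign)+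
  obtain u w where uw: "has_ac_deriv u force" "has_ac_deriv w force"
    "AE x in lborel. x > 0 \<longrightarrow> a x * weak_deriv \<phi> x = w x"
    "AE x in lborel. x < 0 \<longrightarrow> a x * weak_deriv \<phi> x = u x"
    using flux_exists by blast
  interpret critical_flux a \<phi> u w
    by standard (fact uw)+
  show ?thesis
    using direction_H1 angle_unstable v_H1 v_tangent map_unstable[OF m_eq] no_minimizer
    unfolding m_eq by blast
qed

end
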